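(* Suppose $m\ge\tilde m$ with $\tilde m,m\in\mathbb{Z}_{\ge0}$, and let $n$ be even. Let $\varphi_1,\dots,\varphi_n$ be the angles of the multiplicity-one vectors of the configuration $\mathcal{A}_{(m,\tilde m,1^n)}$ normalized by $\alpha_0=(1,0)$. Let $$L=-\partial_\varphi^2+\frac{m(m+1)}{\sin^2\varphi}+\frac{\tilde m(\tilde m+1)}{\cos^2\varphi}+\sum_{j=1}^n\frac{2}{\sin^2(\varphi-\varphi_j)},\qquad Q(\varphi)=e^{-in\varphi}\prod_{j=1}^n\left(e^{2i\varphi}-e^{2i\varphi_j}\right).$$ Let $\chi_j(\varphi)=\sin(k_j\varphi)$, where $1\le j\le m$, and $k_j=j$ for $j=1,\dots,m-\tilde m$, $k_{m-\tilde m+j}=m-\tilde m+2j$ for $j=1,\dots,\tilde m-1$, and $k_m=\tilde m+m+n$ (when $\tilde m=0$, this last value of $k_m$ takes precedence over the first rule). Then $$L=-\partial_\varphi^2-2\left(\frac{\partial}{\partial\varphi}\right)^2\log W[\chi_1,\dots,\chi_m],$$ where $W$ is the Wronskian of the functions $\chi_1(\varphi),\dots,\chi_m(\varphi)$. Furthermore, $$Q(\varphi)=\nu\,(\cos\varphi)^{-\frac{\tilde m(\tilde m+1)}2}(\sin\varphi)^{-\frac{m(m+1)}2}\,W[\chi_1,\dots,\chi_m],$$ where $\nu=2^{-\frac{\tilde m(\tilde m+1)}2-\frac{m(m-1)}2}(-1)^{\frac{m(m-1)}2}\prod_{1\le q<p\le m}(k_p-k_q)^{-1}$.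
   Context: The configuration $\mathcal{A}_{(m,\tilde m,1^n)}$ ($n$ even) consists of pairwise non-collinear vectors $\alpha_s=(\cos\varphi_s,\sin\varphi_s)\in\mathbb{R}^2$, $0\le s\le n+1$, with multiplicities $m_0=m$, $m_{n+1}=\tilde m$, $m_i=1$ for $1\le i\le n$, such that: $\alpha_0\perp\alpha_{n+1}$; the corresponding arrangement of lines is symmetric with respect to the reflection about $\alpha_0$; and, with $z_s=e^{2i\varphi_s}$, one has $\sum_{i=0,\,i\ne j}^{n+1}\frac{m_i(z_i+z_j)}{z_i-z_j}=0$ for all $j=1,\dots,n$. Such a configuration exists and is unique up to equivalence (orthogonal transformations and rescaling of the vectors). It is normalized here by $\alpha_0=(1,0)$, so $z_0=1$ and $z_{n+1}=-1$. A vector of multiplicity $0$ contributes nothing to the sums.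
   Formalization: The case m = m̃ = 0 with n ≥ 2 is excluded: there are then no functions χ_j, so W = 1 and the claim would read L = −∂², which is false since L contains the terms 2/sin²(φ−φ_j) (e.g. n = 2, φ_j = ±π/4). *)

theory Defs
  imports "HOL-Analysis.Analysis" "Jordan_Normal_Form.Determinant"
begin

definition dir :: "real \<Rightarrow> real \<times> real" where
  "dir t = (cos t, sin t)"

definition hyperplane :: "real \<times> real \<Rightarrow> (real \<times> real) set" where
  "hyperplane a = {x. inner a x = 0}"

definition reflection :: "real \<times> real \<Rightarrow> real \<times> real \<Rightarrow> real \<times> real" where
  "reflection a x = x - (2 * inner a x / inner a a) *\<^sub>R a"

definition cfg_mult :: "nat \<Rightarrow> nat \<Rightarrow> nat \<Rightarrow> nat \<Rightarrow> nat" where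
  "cfg_mult m m' n s = (if s = 0 then m else if s = n + 1 then m' else 1)"

definition zpt :: "(nat \<Rightarrow> real) \<Rightarrow> nat \<Rightarrow> complex" where
  "zpt \<phi> s = exp (2 * \<i> * complex_of_real (\<phi> s))"

(* The angle function \<phi> is only relevant on the indices 0, ..., n + 1. *)
definition is_configuration :: "nat \<Rightarrow> nat \<Rightarrow> nat \<Rightarrow> (nat \<Rightarrow> real) \<Rightarrow> bool" where
  "is_configuration m m' n \<phi> \<longleftrightarrow>
     (\<forall>s\<in>{0..n+1}. \<forall>t\<in>{0..n+1}. s \<noteq> t \<longrightarrow> \<not> collinear {0, dir (\<phi> s), dir (\<phi> t)}) \<and>
     Linear_Algebra.orthogonal (dir (\<phi> 0)) (dir (\<phi> (n + 1))) \<and>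
     (\<lambda>H. reflection (dir (\<phi> 0)) ` H) ` ((\<lambda>s. hyperplane (dir (\<phi> s))) ` {0..n+1})
       = (\<lambda>s. hyperplane (dir (\<phi> s))) ` {0..n+1} \<and>
     (\<forall>j\<in>{1..n}. (\<Sum>i\<in>{0..n+1} - {j}.
         of_nat (cfg_mult m m' n i) * (zpt \<phi> i + zpt \<phi> j) / (zpt \<phi> i - zpt \<phi> j)) = 0)"

definition potential :: "nat \<Rightarrow> nat \<Rightarrow> nat \<Rightarrow> (nat \<Rightarrow> real) \<Rightarrow> real \<Rightarrow> real" where
  "potential m m' n \<phi> x =
     real (m * (m + 1)) / (sin x)\<^sup>2 + real (m' * (m' + 1)) / (cos x)\<^sup>2
     + (\<Sum>j=1..n. 2 / (sin (x - \<phi> j))\<^sup>2)"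

definition L_op :: "nat \<Rightarrow> nat \<Rightarrow> nat \<Rightarrow> (nat \<Rightarrow> real) \<Rightarrow> (real \<Rightarrow> real) \<Rightarrow> real \<Rightarrow> real" where
  "L_op m m' n \<phi> f x = - (deriv ^^ 2) f x + potential m m' n \<phi> x * f x"

definition Q_fun :: "nat \<Rightarrow> (nat \<Rightarrow> real) \<Rightarrow> real \<Rightarrow> complex" where
  "Q_fun n \<phi> x = exp (- \<i> * of_nat n * of_real x) *
     (\<Prod>j=1..n. exp (2 * \<i> * of_real x) - exp (2 * \<i> * of_real (\<phi> j)))"

(* For m' \<le> m and 1 \<le> j \<le> m. The last branch is the rule
   k_(m - m' + i) = m - m' + 2 i, rewritten with j = m - m' + i. *)
definition kexp :: "nat \<Rightarrow> nat \<Rightarrow> nat \<Rightarrow> nat \<Rightarrow> nat" where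
  "kexp m m' n j =
     (if j = m then m' + m + n
      else if j \<le> m - m' then j
      else (m - m') + 2 * (j - (m - m')))"

definition chi :: "nat \<Rightarrow> nat \<Rightarrow> nat \<Rightarrow> nat \<Rightarrow> real \<Rightarrow> real" where
  "chi m m' n j x = sin (real (kexp m m' n j) * x)"

(* Wronskian of f 1, ..., f N; equal to 1 for N = 0. *)
definition wronskian :: "nat \<Rightarrow> (nat \<Rightarrow> real \<Rightarrow> real) \<Rightarrow> real \<Rightarrow> real" where
  "wronskian N f x = Determinant.det (Matrix.mat N N (\<lambda>(i, j). (deriv ^^ i) (f (j + 1)) x))"

definition nu :: "nat \<Rightarrow> nat \<Rightarrow> nat \<Rightarrow> real" where
  "nu m m' n =
     2 powi (- int (m' * (m' + 1) div 2) - int (m * (m - 1) div 2)) *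
     (-1) ^ (m * (m - 1) div 2) *
     (\<Prod>p=1..m. \<Prod>q=1..<p. inverse (real (kexp m m' n p) - real (kexp m m' n q)))"

(* The factors sin and cos are required to be nonzero only if they actually occur,
   so that for m' = 0 the zeros of cos are not excluded (and similarly for m = 0 and sin). *)
definition off_axes :: "nat \<Rightarrow> nat \<Rightarrow> real \<Rightarrow> bool" where
  "off_axes m m' x \<longleftrightarrow> (m = 0 \<or> sin x \<noteq> 0) \<and> (m' = 0 \<or> cos x \<noteq> 0)"

definition nonsingular :: "nat \<Rightarrow> nat \<Rightarrow> nat \<Rightarrow> (nat \<Rightarrow> real) \<Rightarrow> real \<Rightarrow> bool" where
  "nonsingular m m' n \<phi> x \<longleftrightarrow> off_axes m m' x \<and> (\<forall>j\<in>{1..n}. sin (x - \<phi> j) \<noteq> 0)"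

end

theory Submission
  imports Defs
begin

text \<open>Write \<open>sin (k x) = sin x \<cdot> U (cos x)\<close> with a Chebyshev polynomial \<open>U\<close> of degree \<open>k - 1\<close>. In the
  variable \<open>t = cos x\<close> the Wronskian of the \<open>\<chi>\<^sub>j\<close> becomes, up to powers of \<open>sin x\<close>, the Wronskian of
  Chebyshev polynomials. All but the last of these span the same flag as the monomials \<open>t ^ (k - 1)\<close>,
  and Wronskians of monomials are Vandermonde determinants times a power of \<open>t\<close>, so expanding the last
  column in powers of \<open>t\<close> gives the coefficients of the Wronskian explicitly. By the Chebyshev
  differential equation they satisfy a two-term recurrence.

  On the other side the lines other than the two axes come in mirror pairs, so that
  \<open>Q = 2 ^ n \<cdot> Y (cos\<^sup>2 x)\<close> where \<open>Y\<close> has the simple roots \<open>cos\<^sup>2 \<phi>\<^sub>j\<close>. The equations of the configuration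
  are Stieltjes' equilibrium conditions for these roots; they force a hypergeometric equation for \<open>Y\<close>
  and hence the same recurrence. Both formulas follow by comparing leading coefficients, the first one
  from the logarithmic derivative.\<close>

subsection \<open>Wronskians of polynomials\<close>

text \<open>A Vandermonde determinant with the powers replaced by monic polynomials. As a polynomial
  in the last point, the determinant of size \<open>Suc m\<close> has degree at most
  \<open>m\<close>, vanishes at the other points and has the determinant of size \<open>m\<close> as
  its coefficient at degree \<open>m\<close>.\<close>

lemma det_monic_poly_eval:
  fixes q :: "nat \<Rightarrow> 'a :: idom poly" and x :: "nat \<Rightarrow> 'a"
  assumes deg: "\<And>i. degree (q i) \<le> i" and monic: "\<And>i. coeff (q i) i = 1"
  shows "Determinant.det (Matrix.mat m m (\<lambda>(i, j). poly (q i) (x j))) = (\<Prod>j<m. \<Prod>i<j. x j - x i)"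
proof (induction m)
  case 0
  show ?case by simp
next
  case (Suc m)
  define A where "A = (\<lambda>y. Matrix.mat (Suc m) (Suc m) (\<lambda>(i, j). poly (q i) ((x(m := y)) j)))"
  define c where "c i = cofactor (A 0) i m" for i
  define D where "D = (\<Sum>i<Suc m. Polynomial.smult (c i) (q i))"
  have A: "A y \<in> carrier_mat (Suc m) (Suc m)" for y by (simp add: A_def)
  have cof: "cofactor (A y) i m = c i" for y i
  proof -
    have "mat_delete (A y) i m = mat_delete (A 0) i m"
      by (rule eq_matI) (auto simp: mat_delete_def A_def)
    then show ?thesis by (simp add: c_def cofactor_def)
  qed
  have detA: "Determinant.det (A y) = poly D y" for y
  proof -
    have "Determinant.det (A y) = (\<Sum>i<Suc m. A y $$ (i, m) * cofactor (A y) i m)"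
      by (rule laplace_expansion_column[OF A lessI])
    also have "\<dots> = (\<Sum>i<Suc m. c i * poly (q i) y)"
      unfolding cof by (intro sum.cong) (auto simp: A_def)
    finally show ?thesis by (simp add: D_def poly_sum)
  qed
  have vanish: "poly D (x j) = 0" if "j < m" for j
  proof -
    have "Matrix.col (A (x j)) j = Matrix.col (A (x j)) m"
      using that by (intro eq_vecI) (auto simp: A_def)
    then have "Determinant.det (A (x j)) = 0"
      using det_identical_columns[OF A, of j m] that by auto
    then show ?thesis using detA by simp
  qed
  have degD: "degree D \<le> m" unfolding D_def
    by (intro degree_sum_le) (auto intro: order.trans[OF degree_smult_le] order.trans[OF deg])
  have "coeff D m = (\<Sum>i<Suc m. c i * coeff (q i) m)"
    by (simp add: D_def coeff_sum)
  also have "\<dots> = c m"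
  proof -
    have "coeff (q i) m = 0" if "i < m" for i
      by (rule coeff_eq_0) (use deg[of i] that in linarith)
    then show ?thesis by (simp add: monic)
  qed
  also have "c m = (\<Prod>j<m. \<Prod>i<j. x j - x i)"
  proof -
    have "mat_delete (A 0) m m = Matrix.mat m m (\<lambda>(i, j). poly (q i) (x j))"
      by (rule eq_matI) (auto simp: mat_delete_def A_def)
    then show ?thesis by (simp add: c_def cofactor_def Suc.IH)
  qed
  finally have lead: "coeff D m = (\<Prod>j<m. \<Prod>i<j. x j - x i)" .
  have "poly D (x m) = (\<Prod>j<m. \<Prod>i<j. x j - x i) * (\<Prod>i<m. x m - x i)"
  proof (cases "inj_on x {..<m}")
    case True
    define E where "E = Polynomial.smult (coeff D m) (\<Prod>i<m. [:- x i, 1:])"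
    have degE: "degree (\<Prod>i<m. [:- x i, 1:]) = m"
      by (subst degree_prod_eq_sum_degree) auto
    have "lead_coeff (\<Prod>i<m. [:- x i, 1:]) = 1"
      by (simp add: lead_coeff_prod)
    then have "coeff E m = coeff D m"
      by (simp add: E_def degE)
    moreover have "degree E \<le> m"
      using degE degree_smult_le[of "coeff D m" "\<Prod>i<m. [:- x i, 1:]"] by (simp add: E_def)
    moreover have "card (x ` {..<m}) \<ge> m"
      using card_image[OF True] by simp
    moreover have "poly D z = poly E z" if "z \<in> x ` {..<m}" for z
      using that vanish by (auto simp: E_def poly_prod)
    ultimately have "D = E"
      using degD by (intro poly_eqI_degree_lead_coeff[of D m E "x ` {..<m}"]) auto
    then show ?thesis by (simp add: E_def poly_prod lead)
  next
    case False
    then obtain i j where ij: "i < m" "j < m" "i < j" "x i = x j"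
      unfolding inj_on_def by (metis lessThan_iff linorder_neqE_nat)
    have "Matrix.col (A (x m)) i = Matrix.col (A (x m)) j"
      using ij by (intro eq_vecI) (auto simp: A_def)
    then have "poly D (x m) = 0"
      using det_identical_columns[OF A, of i j] ij detA by auto
    moreover have "(\<Prod>i<j. x j - x i) = 0"
      using ij(3,4) by (intro prod_zero bexI[of _ i]) auto
    then have "(\<Prod>j<m. \<Prod>i<j. x j - x i) = 0"
      using ij(2) by (intro prod_zero) auto
    ultimately show ?thesis by simp
  qed
  then show ?case
    using detA[of "x m"] unfolding A_def fun_upd_triv by simp
qed

text \<open>Columns are numbered from 0 here, but from 1 in \<open>wronskian\<close>.\<close>

definition pwronskian :: "nat \<Rightarrow> (nat \<Rightarrow> 'a :: idom poly) \<Rightarrow> 'a poly" where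
  "pwronskian m p = Determinant.det (Matrix.mat m m (\<lambda>(i, j). (pderiv ^^ i) (p j)))"

text \<open>The factor \<open>t^i\<close> restores the degree lost by differentiation, so no
  truncated exponent \<open>e - i\<close> appears. What remains is a falling factorial, monic of
  degree \<open>i\<close> in \<open>e\<close>.\<close>

lemma pderiv_power_monom:
  fixes e :: nat
  shows "monom (1 :: 'a :: idom) i * (pderiv ^^ i) (monom 1 e) =
     monom (poly (\<Prod>k<i. [:- of_nat k, 1:]) (of_nat e)) e"
proof (induction i)
  case 0
  show ?case by simp
next
  case (Suc i)
  let ?f = "\<lambda>i. poly (\<Prod>k<i. [:- of_nat k, 1:]) (of_nat e) :: 'a"
  have "pderiv (monom 1 i * (pderiv ^^ i) (monom 1 e)) = pderiv (monom (?f i) e)"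
    using Suc.IH by simp
  then have D: "monom (1 :: 'a) i * (pderiv ^^ Suc i) (monom 1 e)
      + (pderiv ^^ i) (monom 1 e) * pderiv (monom 1 i) = pderiv (monom (?f i) e)"
    by (simp add: pderiv_mult)
  \<comment> \<open>The Euler operator \<open>t d/dt\<close>, which has the monomials as
    eigenvectors.\<close>
  have X: "monom 1 1 * pderiv (monom (b :: 'a) k) = monom (of_nat k * b) k" for b k
    by (cases k) (simp_all add: pderiv_monom mult_monom)
  have X1: "monom (1 :: 'a) 1 * pderiv (monom 1 i) = monom (of_nat i) i"
    using X[of 1 i] by simp
  have "monom (1 :: 'a) (Suc i) * (pderiv ^^ Suc i) (monom 1 e) + monom (of_nat i) i * (pderiv ^^ i) (monom 1 e)
      = (monom 1 1 * monom 1 i) * (pderiv ^^ Suc i) (monom 1 e)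
        + (monom 1 1 * pderiv (monom 1 i)) * (pderiv ^^ i) (monom 1 e)"
    unfolding X1 by (simp add: mult_monom)
  also have "\<dots> = monom 1 1 * (monom 1 i * (pderiv ^^ Suc i) (monom 1 e)
      + (pderiv ^^ i) (monom 1 e) * pderiv (monom 1 i))"
    by (simp only: distrib_left mult_ac)
  also have "\<dots> = monom (of_nat e * ?f i) e"
    unfolding D X ..
  finally have "monom (1 :: 'a) (Suc i) * (pderiv ^^ Suc i) (monom 1 e)
      = monom (of_nat e * ?f i) e - monom (of_nat i) i * (pderiv ^^ i) (monom 1 e)"
    by (simp only: eq_diff_eq)
  also have "monom (of_nat i :: 'a) i * (pderiv ^^ i) (monom 1 e) = monom (of_nat i * ?f i) e"
  proof -
    have "monom (of_nat i) i = Polynomial.smult (of_nat i) (monom (1 :: 'a) i)"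
      by (simp add: smult_monom)
    then have "monom (of_nat i) i * (pderiv ^^ i) (monom 1 e)
        = Polynomial.smult (of_nat i) (monom (1 :: 'a) i * (pderiv ^^ i) (monom 1 e))"
      by simp
    also have "\<dots> = monom (of_nat i * ?f i) e"
      by (simp only: Suc.IH smult_monom)
    finally show ?thesis .
  qed
  also have "monom (of_nat e * ?f i) e - monom (of_nat i * ?f i) e = monom (?f (Suc i)) e"
    by (simp add: diff_monom algebra_simps)
  finally show ?case .
qed

text \<open>Scaling row \<open>i\<close> by \<open>t^i\<close> and taking \<open>t^(e j)\<close> out
  of column \<open>j\<close> leaves a constant matrix of falling factorials, which
  \<open>det_monic_poly_eval\<close> evaluates.\<close>

lemma pwronskian_monom:
  fixes e :: "nat \<Rightarrow> nat"
  shows "monom 1 (\<Sum>i<m. i) * pwronskian m (\<lambda>j. monom 1 (e j)) =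
    monom (\<Prod>j<m. \<Prod>i<j. of_nat (e j) - of_nat (e i)) (\<Sum>j<m. e j)"
proof -
  let ?q = "\<lambda>i. \<Prod>k<i. [:- of_nat k, 1 :: 'a :: idom:]"
  let ?W = "Matrix.mat m m (\<lambda>(i, j). (pderiv ^^ i) (monom (1 :: 'a) (e j)))"
  let ?F = "Matrix.mat m m (\<lambda>(i, j). poly (?q i) (of_nat (e j)))"
  let ?L = "\<lambda>c :: 'a. [:c:]"
  let ?D = "\<lambda>d. Matrix.mat m m (\<lambda>(i, j). if i = j then monom (1 :: 'a) (d i) else 0)"
  interpret L: comm_ring_hom ?L
    by unfold_locales (auto simp: one_pCons)
  have detD: "Determinant.det (?D d) = monom 1 (\<Sum>i<m. d i)" for d :: "nat \<Rightarrow> nat"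
  proof -
    have "Determinant.det (?D d) = (\<Prod>i<m. monom 1 (d i))"
      by (subst det_upper_triangular[of _ m])
        (auto simp: upper_triangular_def prod_list_diag_prod atLeast0LessThan intro!: prod.cong)
    also have "\<dots> = monom 1 (\<Sum>i<m. d i)"
      by (induction m) (auto simp: mult_monom)
    finally show ?thesis .
  qed
  have "?D (\<lambda>i. i) * ?W = map_mat ?L ?F * ?D e"
  proof (rule eq_matI)
    fix i j assume "i < dim_row (map_mat ?L ?F * ?D e)" "j < dim_col (map_mat ?L ?F * ?D e)"
    then have ij: "i < m" "j < m" by auto
    have "(?D (\<lambda>i. i) * ?W) $$ (i, j) = monom 1 i * (pderiv ^^ i) (monom 1 (e j))"
      using ij by (simp add: scalar_prod_def if_distrib[where f = "\<lambda>a. a * _"] cong: if_cong)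
    also have "\<dots> = monom (poly (?q i) (of_nat (e j))) (e j)"
      by (rule pderiv_power_monom)
    also have "\<dots> = (map_mat ?L ?F * ?D e) $$ (i, j)"
      using ij by (simp add: scalar_prod_def if_distrib[where f = "\<lambda>a. _ * a"] smult_monom cong: if_cong)
    finally show "(?D (\<lambda>i. i) * ?W) $$ (i, j) = (map_mat ?L ?F * ?D e) $$ (i, j)" .
  qed auto
  then have "Determinant.det (?D (\<lambda>i. i) * ?W) = Determinant.det (map_mat ?L ?F * ?D e)"
    by simp
  then have "Determinant.det (?D (\<lambda>i. i)) * Determinant.det ?W = Determinant.det (map_mat ?L ?F) * Determinant.det (?D e)"
    by (simp add: det_mult[of _ m])
  moreover have "Determinant.det ?F = (\<Prod>j<m. \<Prod>i<j. of_nat (e j) - of_nat (e i))"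
  proof (rule det_monic_poly_eval)
    fix i
    have deg: "degree (?q i) = i"
      by (subst degree_prod_eq_sum_degree) auto
    show "degree (?q i) \<le> i" using deg by simp
    have "lead_coeff (?q i) = 1" by (simp add: lead_coeff_prod)
    then show "coeff (?q i) i = 1" using deg by simp
  qed
  ultimately show ?thesis
    by (simp add: detD L.hom_det pwronskian_def smult_monom)
qed

subsection \<open>Wronskians of sine functions and Chebyshev polynomials\<close>

text \<open>A class of differentiable functions closed under \<open>deriv\<close>; it serves to show
  that every \<open>sin_deriv_coeff\<close> is differentiable.\<close>

definition trig_polys :: "(real \<Rightarrow> real) set" where
  "trig_polys = {f. \<exists>P R. f = (\<lambda>x. poly P (cos x) + sin x * poly R (cos x))}"

lemma DERIV_poly_cos [derivative_intros]:
  "((\<lambda>x. poly P (cos x)) has_real_derivative - sin x * poly (pderiv P) (cos x)) (at x)"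
  using DERIV_chain2[OF poly_DERIV DERIV_cos] by (simp add: mult.commute)

lemma sin_times_sin: "sin x * (sin x * y) = (1 - cos x * cos x) * (y :: real)"
  using sin_cos_squared_add[of x] by (simp add: power2_eq_square algebra_simps flip: distrib_left)

lemma trig_polys_deriv:
  assumes "f \<in> trig_polys"
  shows "(f has_real_derivative deriv f x) (at x)" "deriv f \<in> trig_polys"
proof -
  obtain P R where f: "f = (\<lambda>x. poly P (cos x) + sin x * poly R (cos x))"
    using assms by (auto simp: trig_polys_def)
  have D: "(f has_real_derivative poly ([:0, 1:] * R - [:1, 0, -1:] * pderiv R) (cos x)
      + sin x * poly (- pderiv P) (cos x)) (at x)" for x
    unfolding f by (auto intro!: derivative_eq_intros simp: sin_times_sin algebra_simps)
  then have eq: "deriv f = (\<lambda>x. poly ([:0, 1:] * R - [:1, 0, -1:] * pderiv R) (cos x)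
      + sin x * poly (- pderiv P) (cos x))"
    by (auto intro: DERIV_imp_deriv)
  show "(f has_real_derivative deriv f x) (at x)"
    using D unfolding eq .
  show "deriv f \<in> trig_polys"
    unfolding eq trig_polys_def by blast
qed

lemma trig_polys_sin_times:
  assumes "f \<in> trig_polys"
  shows "(\<lambda>x. sin x * f x) \<in> trig_polys"
proof -
  obtain P R where f: "f = (\<lambda>x. poly P (cos x) + sin x * poly R (cos x))"
    using assms by (auto simp: trig_polys_def)
  have "(\<lambda>x. sin x * f x) = (\<lambda>x. poly ([:1, 0, -1:] * R) (cos x) + sin x * poly P (cos x))"
    by (auto simp: f sin_times_sin algebra_simps)
  then show ?thesis unfolding trig_polys_def by blast
qed

lemma trig_polys_diff:
  assumes "f \<in> trig_polys" "g \<in> trig_polys"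
  shows "(\<lambda>x. f x - g x) \<in> trig_polys"
proof -
  obtain P R P' R' where "f = (\<lambda>x. poly P (cos x) + sin x * poly R (cos x))"
      "g = (\<lambda>x. poly P' (cos x) + sin x * poly R' (cos x))"
    using assms by (auto simp: trig_polys_def)
  then have "(\<lambda>x. f x - g x) = (\<lambda>x. poly (P - P') (cos x) + sin x * poly (R - R') (cos x))"
    by (auto simp: algebra_simps)
  then show ?thesis unfolding trig_polys_def by blast
qed

lemma trig_polys_zero: "(\<lambda>x. 0) \<in> trig_polys"
  unfolding trig_polys_def by (auto intro!: exI[of _ 0])

lemma trig_polys_sin: "sin \<in> trig_polys"
  unfolding trig_polys_def by (intro CollectI exI[of _ 0] exI[of _ 1]) auto

text \<open>The coefficients of the derivatives of \<open>p\<close> in the \<open>i\<close>-th derivative of \<open>sin x \<cdot> p (cos x)\<close>; they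
  are the entries of a lower triangular matrix.\<close>

primrec sin_deriv_coeff :: "nat \<Rightarrow> nat \<Rightarrow> real \<Rightarrow> real" where
  "sin_deriv_coeff 0 l = (if l = 0 then sin else (\<lambda>x. 0))"
| "sin_deriv_coeff (Suc i) l =
    (\<lambda>x. deriv (sin_deriv_coeff i l) x - (if l = 0 then 0 else sin x * sin_deriv_coeff i (l - 1) x))"

lemma sin_deriv_coeff_in_trig_polys: "sin_deriv_coeff i l \<in> trig_polys"
proof (induction i arbitrary: l)
  case (Suc i)
  show ?case
    by (cases "l = 0")
      (auto intro!: trig_polys_diff trig_polys_sin_times trig_polys_zero trig_polys_deriv(2) Suc)
qed (auto simp: trig_polys_zero trig_polys_sin)

lemma sin_deriv_coeff_eq_0: "i < l \<Longrightarrow> sin_deriv_coeff i l = (\<lambda>x. 0)"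
  by (induction i arbitrary: l) auto

lemma sin_deriv_coeff_diag: "sin_deriv_coeff i i = (\<lambda>x. sin x * (- sin x) ^ i)"
  by (induction i) (auto simp: sin_deriv_coeff_eq_0)

text \<open>Each differentiation either hits a coefficient or turns a derivative of \<open>p\<close>
  into the next one with the factor \<open>- sin x\<close>; this is the recursion of
  \<open>sin_deriv_coeff\<close>.\<close>

lemma higher_deriv_sin_poly_cos:
  "(deriv ^^ i) (\<lambda>x. sin x * poly p (cos x)) =
    (\<lambda>x. \<Sum>l\<le>i. sin_deriv_coeff i l x * poly ((pderiv ^^ l) p) (cos x))"
proof (induction i)
  case 0
  show ?case by simp
next
  case (Suc i)
  let ?a = "sin_deriv_coeff i"
  show ?case (is "?f = ?g")
  proof
    fix x
    have "((\<lambda>x. \<Sum>l\<le>i. ?a l x * poly ((pderiv ^^ l) p) (cos x)) has_real_derivative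
        (\<Sum>l\<le>i. deriv (?a l) x * poly ((pderiv ^^ l) p) (cos x)
          - sin x * ?a l x * poly ((pderiv ^^ Suc l) p) (cos x))) (at x)"
      by (auto intro!: derivative_eq_intros trig_polys_deriv(1) sin_deriv_coeff_in_trig_polys
          simp: algebra_simps)
    then have "?f x = (\<Sum>l\<le>i. deriv (?a l) x * poly ((pderiv ^^ l) p) (cos x)
          - sin x * ?a l x * poly ((pderiv ^^ Suc l) p) (cos x))"
      by (simp add: Suc.IH DERIV_imp_deriv)
    also have "\<dots> = (\<Sum>l\<le>Suc i. deriv (?a l) x * poly ((pderiv ^^ l) p) (cos x))
        - (\<Sum>l\<le>Suc i. (if l = 0 then 0 else sin x * ?a (l - 1) x) * poly ((pderiv ^^ l) p) (cos x))"
      by (subst (2) sum.atMost_Suc_shift) (simp add: sum_subtractf sin_deriv_coeff_eq_0)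
    also have "\<dots> = ?g x"
      by (simp only: sin_deriv_coeff.simps left_diff_distrib sum_subtractf)
    finally show "?f x = ?g x" .
  qed
qed

lemma sum_lessThan_nat: "(\<Sum>i<m. i) = m * (m - 1) div (2 :: nat)"
  using Sum_Ico_nat[of 0 m] by (simp add: atLeast0LessThan)

lemma sum_atMost_nat: "(\<Sum>i\<le>k. i) = k * (k + 1) div (2 :: nat)"
  using gauss_sum_nat[of k] by (simp add: atLeast0AtMost)

lemma triangle_eq: "m * (m + 1) div 2 = m + m * (m - 1) div (2 :: nat)"
  by (cases m) (auto simp: algebra_simps)

text \<open>The Wronskian matrix is a lower triangular matrix times the matrix of derivatives of the
  \<open>p j\<close> at \<open>cos x\<close>; the diagonal entries
  \<open>sin x * (- sin x)^i\<close> give the prefactor.\<close>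

lemma wronskian_sin_poly_cos:
  assumes f: "\<And>j x. j < m \<Longrightarrow> f (Suc j) x = sin x * poly (p j) (cos x)"
  shows "wronskian m f x =
    (-1) ^ (m * (m - 1) div 2) * sin x ^ (m * (m + 1) div 2) * poly (pwronskian m p) (cos x)"
proof -
  let ?A = "Matrix.mat m m (\<lambda>(i, l). sin_deriv_coeff i l x)"
  let ?B = "Matrix.mat m m (\<lambda>(i, j). (pderiv ^^ i) (p j))"
  let ?h = "\<lambda>p. poly p (cos x)"
  interpret poly_hom: comm_ring_hom ?h
    by unfold_locales auto
  have "Matrix.mat m m (\<lambda>(i, j). (deriv ^^ i) (f (j + 1)) x) = ?A * map_mat ?h ?B"
  proof (rule eq_matI)
    fix i j assume "i < dim_row (?A * map_mat ?h ?B)" "j < dim_col (?A * map_mat ?h ?B)"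
    then have ij: "i < m" "j < m" by auto
    have "f (j + 1) = (\<lambda>x. sin x * poly (p j) (cos x))"
      using f[OF ij(2)] by auto
    then have "(deriv ^^ i) (f (j + 1)) x = (\<Sum>l\<le>i. sin_deriv_coeff i l x * ?h ((pderiv ^^ l) (p j)))"
      by (simp only: higher_deriv_sin_poly_cos)
    also have "\<dots> = (\<Sum>l<m. sin_deriv_coeff i l x * ?h ((pderiv ^^ l) (p j)))"
      using ij by (intro sum.mono_neutral_left) (auto simp: sin_deriv_coeff_eq_0)
    finally show "Matrix.mat m m (\<lambda>(i, j). (deriv ^^ i) (f (j + 1)) x) $$ (i, j)
        = (?A * map_mat ?h ?B) $$ (i, j)"
      using ij by (simp add: scalar_prod_def atLeast0LessThan)
  qed auto
  then have "wronskian m f x = Determinant.det ?A * Determinant.det (map_mat ?h ?B)"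
    unfolding wronskian_def by (simp add: det_mult[of _ m])
  also have "Determinant.det (map_mat ?h ?B) = ?h (pwronskian m p)"
    by (simp only: poly_hom.hom_det pwronskian_def)
  also have "Determinant.det ?A = (\<Prod>i<m. sin x * (- sin x) ^ i)"
    by (subst det_lower_triangular[of m])
      (auto simp: sin_deriv_coeff_eq_0 sin_deriv_coeff_diag prod_list_diag_prod atLeast0LessThan intro!: prod.cong)
  also have "\<dots> = sin x ^ m * (- sin x) ^ (\<Sum>i<m. i)"
    by (simp add: prod.distrib power_sum)
  also have "\<dots> = (-1) ^ (m * (m - 1) div 2) * sin x ^ (m * (m + 1) div 2)"
    by (simp only: power_minus[of "sin x"] sum_lessThan_nat triangle_eq power_add mult_ac)
  finally show ?thesis .
qed

section \<open>Chebyshev polynomials of the second kind\<close>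

fun chebU :: "nat \<Rightarrow> real poly" where
  "chebU 0 = 1"
| "chebU (Suc 0) = [:0, 2:]"
| "chebU (Suc (Suc n)) = [:0, 2:] * chebU (Suc n) - chebU n"

lemma sin_chebU: "sin (real (Suc n) * x) = sin x * poly (chebU n) (cos x)"
proof (induction n rule: chebU.induct)
  case (3 n)
  have "sin (real (Suc (Suc (Suc n))) * x) = 2 * cos x * sin (real (Suc (Suc n)) * x) - sin (real (Suc n) * x)"
  proof -
    have "real (Suc (Suc (Suc n))) * x = real (Suc (Suc n)) * x + x"
        "real (Suc n) * x = real (Suc (Suc n)) * x - x"
      by (simp_all add: algebra_simps)
    then show ?thesis by (simp only: sin_add sin_diff) simp
  qed
  also have "\<dots> = sin x * poly (chebU (Suc (Suc n))) (cos x)"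
    by (simp only: "3.IH") (simp add: algebra_simps)
  finally show ?case .
qed (auto simp: sin_double)

lemma degree_chebU: "degree (chebU n) \<le> n"
  by (induction n rule: chebU.induct)
    (auto intro!: degree_diff_le order.trans[OF degree_pCons_le])

lemma lead_coeff_chebU: "coeff (chebU n) n = 2 ^ n"
proof (induction n rule: chebU.induct)
  case (3 n)
  have "coeff (chebU n) (Suc (Suc n)) = 0"
    using degree_chebU[of n] by (intro coeff_eq_0) auto
  with 3 show ?case by simp
qed auto

lemma chebU_parity: "coeff (chebU n) e = 0" if "odd (n + e)"
  using that
proof (induction n arbitrary: e rule: chebU.induct)
  case 1
  then show ?case by (auto elim: oddE)
next
  case 2
  then show ?case by (cases e) (auto simp: coeff_pCons elim: oddE split: nat.splits)
next
  case (3 n)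
  then show ?case by (cases e) auto
qed

text \<open>Differentiating \<open>sin ((n + 1) x) = sin x * U (cos x)\<close> twice gives the
  equation at every \<open>cos x\<close> with \<open>0 < x < pi\<close>, that is, at infinitely many
  points.\<close>

lemma chebU_ode:
  "[:1, 0, -1:] * pderiv (pderiv (chebU n)) - [:0, 3:] * pderiv (chebU n)
    + Polynomial.smult (real n * (real n + 2)) (chebU n) = 0" (is "?P = 0")
proof -
  let ?p = "\<lambda>x. poly (chebU n) (cos x)" and ?p' = "\<lambda>x. poly (pderiv (chebU n)) (cos x)"
    and ?p'' = "\<lambda>x. poly (pderiv (pderiv (chebU n))) (cos x)"
  have D1: "real (Suc n) * cos (real (Suc n) * x) = cos x * ?p x - sin x ^ 2 * ?p' x" for x
  proof (rule DERIV_unique)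
    show "((\<lambda>x. sin (real (Suc n) * x)) has_real_derivative real (Suc n) * cos (real (Suc n) * x)) (at x)"
      by (auto intro!: derivative_eq_intros)
    show "((\<lambda>x. sin (real (Suc n) * x)) has_real_derivative cos x * ?p x - sin x ^ 2 * ?p' x) (at x)"
      unfolding sin_chebU by (auto intro!: derivative_eq_intros simp: algebra_simps power2_eq_square)
  qed
  have D2: "real (Suc n) ^ 2 * - sin (real (Suc n) * x)
      = sin x * (sin x ^ 2 * ?p'' x - 3 * cos x * ?p' x - ?p x)" for x
  proof (rule DERIV_unique)
    show "((\<lambda>x. real (Suc n) * cos (real (Suc n) * x)) has_real_derivative
        real (Suc n) ^ 2 * - sin (real (Suc n) * x)) (at x)"
      by (auto intro!: derivative_eq_intros simp: power2_eq_square)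
    show "((\<lambda>x. real (Suc n) * cos (real (Suc n) * x)) has_real_derivative
        sin x * (sin x ^ 2 * ?p'' x - 3 * cos x * ?p' x - ?p x)) (at x)"
      unfolding D1 by (auto intro!: derivative_eq_intros simp: algebra_simps power2_eq_square)
  qed
  have "poly ?P (cos x) = 0" if "x \<in> {0<..<pi}" for x
  proof -
    have "sin x > 0" using that by (auto intro: sin_gt_zero)
    moreover have "sin x * (sin x ^ 2 * ?p'' x - 3 * cos x * ?p' x - ?p x + real (Suc n) ^ 2 * ?p x) = 0"
      using D2[of x] unfolding sin_chebU by (simp add: algebra_simps)
    ultimately have "sin x ^ 2 * ?p'' x - 3 * cos x * ?p' x - ?p x + real (Suc n) ^ 2 * ?p x = 0"
      by simp
    moreover have "sin x ^ 2 = 1 - cos x ^ 2" by (simp add: sin_squared_eq)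
    ultimately have "(1 - cos x ^ 2) * ?p'' x - 3 * cos x * ?p' x - ?p x + real (Suc n) ^ 2 * ?p x = 0"
      by metis
    then show ?thesis by (simp add: algebra_simps power2_eq_square)
  qed
  then have sub: "cos ` {0<..<pi} \<subseteq> {t. poly ?P t = 0}" by blast
  have "inj_on cos {0<..<pi}"
    using cos_inj_pi by (intro inj_onI) auto
  then have "infinite (cos ` {0<..<pi})"
    by (simp add: finite_image_iff)
  then have "infinite {t. poly ?P t = 0}"
    using sub finite_subset by blast
  then show ?thesis
    using poly_roots_finite by blast
qed

text \<open>Coefficient comparison in the differential equation;
  \<open>e (e - 1) + 3 e - n (n + 2)\<close> splits into the two linear factors.\<close>

lemma chebU_coeff_rec:
  "real ((e + 2) * (e + 1)) * coeff (chebU n) (e + 2) =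
    (real e - real n) * (real e + real n + 2) * coeff (chebU n) e"
proof -
  have "[:1, 0, -1:] = 1 - monom (1 :: real) 2" "[:0, 3:] = monom (3 :: real) 1"
    by (simp_all add: monom_altdef numeral_2_eq_2 one_pCons)
  then have "coeff (pderiv (pderiv (chebU n)) - monom 1 2 * pderiv (pderiv (chebU n))
      - monom 3 1 * pderiv (chebU n) + Polynomial.smult (real n * (real n + 2)) (chebU n)) e = 0"
    using chebU_ode[of n] by (simp add: left_diff_distrib)
  then have "real (Suc e) * (real (Suc (Suc e)) * coeff (chebU n) (Suc (Suc e)))
      - coeff (monom 1 2 * pderiv (pderiv (chebU n))) e - coeff (monom 3 1 * pderiv (chebU n)) e
      + real n * (real n + 2) * coeff (chebU n) e = 0"
    by (simp only: coeff_add coeff_diff coeff_smult coeff_pderiv)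
  moreover have "coeff (monom 1 2 * pderiv (pderiv (chebU n))) e = real e * (real e - 1) * coeff (chebU n) e"
    by (cases e rule: chebU.cases) (simp_all only: coeff_monom_mult coeff_pderiv, simp_all)
  moreover have "coeff (monom 3 1 * pderiv (chebU n)) e = 3 * real e * coeff (chebU n) e"
    by (cases e) (simp_all only: coeff_monom_mult coeff_pderiv, simp_all)
  ultimately show ?thesis
    by (simp add: algebra_simps)
qed

section \<open>Wronskians under change of basis and expansion in the last column\<close>

lemma higher_pderiv_sum_smult:
  "(pderiv ^^ i) (\<Sum>k\<in>S. Polynomial.smult (c k) (p k)) =
    (\<Sum>k\<in>S. Polynomial.smult (c k) ((pderiv ^^ i) (p k)))"
  for c :: "_ \<Rightarrow> 'a :: idom"
  by (simp add: higher_pderiv_sum higher_pderiv_smult)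

lemma smult_sum_right:
  "Polynomial.smult c (\<Sum>k\<in>S. p k) = (\<Sum>k\<in>S. Polynomial.smult c (p k))"
  by (induction S rule: infinite_finite_induct) (auto simp: smult_add_right)

text \<open>Constants commute with differentiation, so a change of basis multiplies the Wronskian
  matrix by \<open>T\<close> from the right.\<close>

lemma pwronskian_triangular:
  fixes T :: "nat \<Rightarrow> nat \<Rightarrow> 'a :: idom"
  assumes p: "\<And>j. j < m \<Longrightarrow> p j = (\<Sum>i<m. Polynomial.smult (T i j) (b i))"
    and T: "\<And>i j. j < i \<Longrightarrow> i < m \<Longrightarrow> T i j = 0"
  shows "pwronskian m p = Polynomial.smult (\<Prod>j<m. T j j) (pwronskian m b)"
proof -
  let ?L = "\<lambda>c :: 'a. [:c:]"
  let ?T = "Matrix.mat m m (\<lambda>(i, j). T i j)"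
  let ?M = "\<lambda>p. Matrix.mat m m (\<lambda>(i, j). (pderiv ^^ i) (p j))"
  interpret L: comm_ring_hom ?L
    by unfold_locales (auto simp: one_pCons)
  have "?M p = ?M b * map_mat ?L ?T"
    by (rule eq_matI)
      (auto simp: p higher_pderiv_sum_smult scalar_prod_def atLeast0LessThan mult.commute)
  then have "pwronskian m p = pwronskian m b * [:Determinant.det ?T:]"
    unfolding pwronskian_def by (simp add: det_mult[of _ m] L.hom_det)
  also have "Determinant.det ?T = (\<Prod>j<m. T j j)"
    by (subst det_upper_triangular[of _ m])
      (auto simp: T upper_triangular_def prod_list_diag_prod atLeast0LessThan intro!: prod.cong)
  finally show ?thesis by simp
qed

text \<open>Laplace expansion along the last column, whose cofactors do not involve its
  entries.\<close>

lemma pwronskian_last_linear: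
  fixes c :: "'b \<Rightarrow> 'a :: idom"
  shows "pwronskian (Suc q) (b(q := \<Sum>k\<in>S. Polynomial.smult (c k) (g k))) =
    (\<Sum>k\<in>S. Polynomial.smult (c k) (pwronskian (Suc q) (b(q := g k))))"
proof -
  let ?M = "\<lambda>h. Matrix.mat (Suc q) (Suc q) (\<lambda>(i, j). (pderiv ^^ i) ((b(q := h)) j))"
  have cof: "cofactor (?M h) i q = cofactor (?M 0) i q" for h i
  proof -
    have "mat_delete (?M h) i q = mat_delete (?M 0) i q"
      by (rule eq_matI) (auto simp: mat_delete_def)
    then show ?thesis by (simp only: cofactor_def)
  qed
  have W: "pwronskian (Suc q) (b(q := h)) = (\<Sum>i<Suc q. (pderiv ^^ i) h * cofactor (?M 0) i q)" for h
  proof -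
    have "pwronskian (Suc q) (b(q := h)) = (\<Sum>i<Suc q. ?M h $$ (i, q) * cofactor (?M h) i q)"
      unfolding pwronskian_def by (rule laplace_expansion_column) auto
    also have "\<dots> = (\<Sum>i<Suc q. (pderiv ^^ i) h * cofactor (?M 0) i q)"
      unfolding cof[of h] by (intro sum.cong) auto
    finally show ?thesis .
  qed
  show ?thesis
    unfolding W higher_pderiv_sum_smult sum_distrib_right smult_sum_right
    by (subst sum.swap) simp
qed

text \<open>The first \<open>q\<close> polynomials are triangular in the monomials with exponents
  \<open>E\<close>, which may replace them at the cost of the diagonal coefficients. Expanding the
  last one by linearity leaves Wronskians of monomials.\<close>

lemma pwronskian_monomial_span:
  fixes p :: "nat \<Rightarrow> 'a :: idom poly" and E :: "nat \<Rightarrow> nat"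
  assumes inj: "inj_on E {..<q}"
    and span: "\<And>j e. j < q \<Longrightarrow> coeff (p j) e \<noteq> 0 \<Longrightarrow> e \<in> E ` {..j}"
  shows "monom 1 (\<Sum>i<Suc q. i) * pwronskian (Suc q) p =
    Polynomial.smult ((\<Prod>j<q. coeff (p j) (E j)) * (\<Prod>j<q. \<Prod>i<j. of_nat (E j) - of_nat (E i)))
     (\<Sum>e\<le>degree (p q). monom (coeff (p q) e * (\<Prod>i<q. of_nat e - of_nat (E i))) (e + (\<Sum>j<q. E j)))"
proof -
  define b where "b = (\<lambda>j. monom (1 :: 'a) (E j))"
  \<comment> \<open>The basis consists of the \<open>q\<close> monomials and the last polynomial
    itself, whence the unit vector in column \<open>q\<close>.\<close>
  define T where "T = (\<lambda>i j. if j < q then if i \<le> j then coeff (p j) (E i) else 0 else if i = j then 1 else 0)"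
  have "pwronskian (Suc q) p = Polynomial.smult (\<Prod>j<Suc q. T j j) (pwronskian (Suc q) (b(q := p q)))"
  proof (rule pwronskian_triangular[where T = T])
    fix j assume j: "j < Suc q"
    show "p j = (\<Sum>i<Suc q. Polynomial.smult (T i j) ((b(q := p q)) i))"
    proof (cases "j = q")
      case True
      then show ?thesis by (simp add: T_def)
    next
      case False
      then have j: "j < q" using j by simp
      have injj: "inj_on E {..j}"
        by (rule inj_on_subset[OF inj]) (use j in auto)
      have "p j = (\<Sum>e\<in>E ` {..j}. monom (coeff (p j) e) e)"
        using span[OF j] by (intro poly_eqI) (auto simp: coeff_sum sum.delta')
      also have "\<dots> = (\<Sum>i\<le>j. Polynomial.smult (T i j) ((b(q := p q)) i))"
        unfolding sum.reindex[OF injj] using j by (intro sum.cong) (auto simp: T_def b_def smult_monom)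
      also have "\<dots> = (\<Sum>i<Suc q. Polynomial.smult (T i j) ((b(q := p q)) i))"
        using j by (intro sum.mono_neutral_left) (auto simp: T_def)
      finally show ?thesis .
    qed
  qed (auto simp: T_def)
  also have "(\<Prod>j<Suc q. T j j) = (\<Prod>j<q. coeff (p j) (E j))"
    by (simp add: T_def)
  also have "p q = (\<Sum>e\<le>degree (p q). Polynomial.smult (coeff (p q) e) (monom 1 e))"
    by (subst poly_as_sum_of_monoms[symmetric]) (simp add: smult_monom)
  also have "pwronskian (Suc q) (b(q := \<dots>)) =
      (\<Sum>e\<le>degree (p q). Polynomial.smult (coeff (p q) e) (pwronskian (Suc q) (b(q := monom 1 e))))"
    by (rule pwronskian_last_linear)
  finally have *: "monom 1 (\<Sum>i<Suc q. i) * pwronskian (Suc q) p =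
    Polynomial.smult (\<Prod>j<q. coeff (p j) (E j)) (\<Sum>e\<le>degree (p q). Polynomial.smult (coeff (p q) e)
      (monom 1 (\<Sum>i<Suc q. i) * pwronskian (Suc q) (b(q := monom 1 e))))"
    by (simp only: mult_smult_right sum_distrib_left)
  have "monom 1 (\<Sum>i<Suc q. i) * pwronskian (Suc q) (b(q := monom 1 e)) =
      Polynomial.smult (\<Prod>j<q. \<Prod>i<j. of_nat (E j) - of_nat (E i))
        (monom (\<Prod>i<q. of_nat e - of_nat (E i)) (e + (\<Sum>j<q. E j)))" for e
  proof -
    have "b(q := monom 1 e) = (\<lambda>j. monom 1 ((E(q := e)) j))"
      by (auto simp: b_def)
    then show ?thesis
      by (simp only: pwronskian_monom) (simp add: smult_monom add.commute)
  qed
  then show ?thesis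
    unfolding * by (simp add: smult_sum_right smult_monom mult_ac)
qed

text \<open>The \<open>j\<close>-th element of the list \<open>0, \<dots>, d - 1, d + 1, d + 3, \<dots>\<close>; with \<open>d = m - m'\<close> it is
  \<open>k - 1\<close> for all exponents \<open>k\<close> except the last one. The gaps have the right parity for the
  corresponding Chebyshev polynomials to span the same flag as the monomials.\<close>

definition kdeg :: "nat \<Rightarrow> nat \<Rightarrow> nat" where
  "kdeg d j = (if j < d then j else d + 1 + 2 * (j - d))"

lemma strict_mono_kdeg: "strict_mono (kdeg d)"
  by (auto simp: strict_mono_def kdeg_def)

lemma kexp_eq_Suc_kdeg:
  assumes "m' \<le> m" "Suc j < m"
  shows "kexp m m' n (Suc j) = Suc (kdeg (m - m') j)"
  using assms by (auto simp: kexp_def kdeg_def)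

lemma kexp_less_kexp:
  assumes "m' \<le> m" "i < j" "j < m"
  shows "kexp m m' n (Suc i) < kexp m m' n (Suc j)"
  using assms by (auto simp: kexp_def)

text \<open>Counts powers of \<open>t\<close>: the fixed columns together with the lowest surviving
  exponent \<open>q + m'\<close> of the last column exceed the cleared power by a triangular
  number.\<close>

lemma sum_kdeg:
  assumes "m' \<le> Suc q"
  shows "(\<Sum>j<q. kdeg (Suc q - m') j) + (q + m') = (\<Sum>i<Suc q. i) + (\<Sum>i\<le>m'. i)"
proof (cases m')
  case 0
  have "kdeg (Suc q) j = j" if "j < q" for j
    using that by (simp add: kdeg_def)
  then show ?thesis using 0 by simp
next
  case (Suc k)
  \<comment> \<open>This is \<open>Suc q - m'\<close>; with it fixed, induction on \<open>k\<close>
    adds one of the exponents \<open>d + 1, d + 3, ...\<close> at a time.\<close>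
  define d where "d = q - k"
  have "(\<Sum>j<d. kdeg d j) = (\<Sum>j<d. j)"
    by (intro sum.cong) (auto simp: kdeg_def)
  then have "(\<Sum>j<d + k. kdeg d j) + (d + k + Suc k) = (\<Sum>i<Suc (d + k). i) + (\<Sum>i\<le>Suc k. i)"
    by (induction k) (auto simp: kdeg_def)
  then show ?thesis using Suc assms by (simp add: d_def)
qed

text \<open>The part of the Vandermonde product that involves the exponent \<open>e\<close> of the
  last column; it vanishes when \<open>e\<close> already occurs among the first \<open>q\<close>
  exponents.\<close>

definition kdeg_prod :: "nat \<Rightarrow> nat \<Rightarrow> nat \<Rightarrow> real" where
  "kdeg_prod d q e = (\<Prod>i<q. real e - real (kdeg d i))"

text \<open>For \<open>q \<le> d\<close> the exponents are consecutive and \<open>kdeg_prod\<close>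
  is a falling factorial, so the shift changes only two factors at each end.\<close>

lemma kdeg_prod_shift_le:
  "q \<le> d \<Longrightarrow> (real e + 2 - real q) * (real e + 1 - real q) * kdeg_prod d q (e + 2)
    = (real e + 2) * (real e + 1) * kdeg_prod d q e"
proof (induction q)
  case (Suc q)
  have "(real e + 2 - real (Suc q)) * (real e + 1 - real (Suc q)) * kdeg_prod d (Suc q) (e + 2)
      = ((real e + 2 - real q) * (real e + 1 - real q) * kdeg_prod d q (e + 2)) * (real e - real q)"
    using Suc.prems by (simp add: kdeg_prod_def kdeg_def algebra_simps)
  also have "\<dots> = (real e + 2) * (real e + 1) * kdeg_prod d (Suc q) e"
    using Suc by (simp add: kdeg_prod_def kdeg_def algebra_simps)
  finally show ?case .
qed (simp add: kdeg_prod_def)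

text \<open>The shift by 2 telescopes: the block \<open>0, ..., d - 1\<close> leaves two factors at
  each end, the block \<open>d + 1, d + 3, ...\<close> leaves one at each end, and
  \<open>e + 1 - d\<close> cancels between them.\<close>

lemma kdeg_prod_shift:
  assumes "d \<le> Suc q"
  shows "(real e + 2 - real d) * (real e + 1 + real d - 2 * real q) * kdeg_prod d q (e + 2)
    = (real e + 2) * (real e + 1) * kdeg_prod d q e"
proof (cases "d = Suc q")
  \<comment> \<open>This case arises from \<open>m' = 0\<close>: the second block is absent and the
    two linear factors change places.\<close>
  case True
  then show ?thesis
    using kdeg_prod_shift_le[of q d e] by (simp add: algebra_simps)
next
  case False
  define k where "k = q - d"
  have "(real e + 2 - real d) * (real e + 1 - real d - 2 * real k) * kdeg_prod d (d + k) (e + 2)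
    = (real e + 2) * (real e + 1) * kdeg_prod d (d + k) e"
  proof (induction k)
    case 0
    then show ?case using kdeg_prod_shift_le[of d d e] by simp
  next
    case (Suc k)
    have "(real e + 2 - real d) * (real e + 1 - real d - 2 * real (Suc k)) * kdeg_prod d (d + Suc k) (e + 2)
      = ((real e + 2 - real d) * (real e + 1 - real d - 2 * real k) * kdeg_prod d (d + k) (e + 2))
        * (real e - (real d + 1 + 2 * real k))"
      by (simp add: kdeg_prod_def kdeg_def algebra_simps)
    also have "\<dots> = (real e + 2) * (real e + 1) * kdeg_prod d (d + Suc k) e"
      unfolding Suc.IH by (simp add: kdeg_prod_def kdeg_def algebra_simps)
    finally show ?case .
  qed
  moreover have "q = d + k" using False assms by (simp add: k_def)
  ultimately show ?thesis by (simp add: algebra_simps)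
qed

text \<open>Of the exponents below \<open>q + m'\<close> with its parity, those below
  \<open>d\<close> lie in the first block and the others make up the second. The last column thus
  effectively starts at \<open>t^(q + m')\<close>.\<close>

lemma kdeg_prod_eq_0:
  assumes "m' \<le> Suc q" "e < q + m'" "even (e + q + m')"
  shows "kdeg_prod (Suc q - m') q e = 0"
proof -
  have "\<exists>i<q. kdeg (Suc q - m') i = e"
  proof (cases "e < Suc q - m'")
    case True
    then show ?thesis using assms
      by (intro exI[of _ e]) (auto simp: kdeg_def)
  next
    case False
    \<comment> \<open>That is, \<open>e = d + k\<close> for \<open>d = Suc q - m'\<close>; parity
      makes \<open>k\<close> odd, as in the second block.\<close>
    then obtain k where k: "e + m' = Suc (q + k)"
      using assms(1) by (metis Suc_diff_le add_Suc le_add_diff_inverse2 le_add_diff_inverse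
        less_or_eq_imp_le linorder_not_less add.commute le_diff_conv le_Suc_ex)
    have "even (e + m' + q)" using assms(3) by (simp add: add_ac)
    then have "odd k" unfolding k by (simp split: if_splits) blast
    then obtain l where l: "k = 2 * l + 1" by (elim oddE)
    show ?thesis
      using k l assms(1,2) False
      by (intro exI[of _ "Suc q - m' + l"]) (auto simp: kdeg_def)
  qed
  then show ?thesis
    unfolding kdeg_prod_def by (intro prod_zero) auto
qed

text \<open>Exponents below \<open>d\<close> are all present, and from \<open>d\<close> on parity
  excludes exactly the gaps \<open>d, d + 2, ...\<close> of the list.\<close>

lemma chebU_kdeg_span:
  assumes "coeff (chebU (kdeg d j)) e \<noteq> 0"
  shows "e \<in> kdeg d ` {..j}"
proof -
  have le: "e \<le> kdeg d j"
    using assms degree_chebU[of "kdeg d j"] le_degree[of "chebU (kdeg d j)" e] by linarith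
  have ev: "even (kdeg d j + e)"
    using assms chebU_parity by blast
  show ?thesis
  proof (cases "e < d")
    case True
    then have "kdeg d e = e" by (simp add: kdeg_def)
    moreover have "e \<le> j"
      using True le by (auto simp: kdeg_def split: if_splits)
    ultimately show ?thesis by force
  next
    case False
    then have j: "d \<le> j" using le by (auto simp: kdeg_def split: if_splits)
    from False obtain k where k: "e = d + k" using le_Suc_ex by (metis linorder_not_less)
    have "odd k" using ev j by (simp add: k kdeg_def)
    then obtain l where l: "k = 2 * l + 1" by (elim oddE)
    have "kdeg d (d + l) = e" "d + l \<le> j"
      using k l le j by (auto simp: kdeg_def)
    then show ?thesis by force
  qed
qed

text \<open>The last column expands into monomials weighted by \<open>A e\<close>, a Chebyshev
  coefficient times a Vandermonde factor. In steps of two \<open>A\<close> obeys the recurrence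
  assumed for \<open>Y\<close>, so it is proportional to the coefficients of
  \<open>Y\<close>.\<close>

lemma pwronskian_chebU_kexp:
  fixes Y :: "real poly"
  assumes m: "m' \<le> m" "m \<ge> 1" and n: "n = 2 * v"
    and Y: "degree Y = v" "coeff Y v = 1"
    and rec: "\<And>r. r < v \<Longrightarrow> (real r + 1) * (real r + real m' + 1/2) * coeff Y (Suc r) =
      (real r - real v) * (real r + real v + real m + real m') * coeff Y r"
  shows "pwronskian m (\<lambda>j. chebU (kexp m m' n (Suc j) - 1)) =
    Polynomial.smult (2 ^ ((\<Sum>i<m. i) + (\<Sum>i\<le>m'. i) + n) *
        (\<Prod>j<m. \<Prod>i<j. real (kexp m m' n (Suc j)) - real (kexp m m' n (Suc i))))
      (monom 1 (\<Sum>i\<le>m'. i) * pcompose Y (monom 1 2))"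
proof -
  obtain q where q: "m = Suc q" using m(2) by (cases m) auto
  define d where "d = m - m'"
  \<comment> \<open>The last exponent is \<open>m + m' + n = Suc N\<close>, so the last column is
    the Chebyshev polynomial of degree \<open>N\<close>.\<close>
  define N where "N = q + m' + n"
  define K where "K = (\<lambda>j. kexp m m' n (Suc j))"
  define S where "S = (\<Sum>j<q. kdeg d j)"
  define A where "A e = coeff (chebU N) e * kdeg_prod d q e" for e
  have d_le: "d \<le> Suc q" and d': "Suc q - m' = d" by (auto simp: d_def q)
  have K_less: "K j = Suc (kdeg d j)" if "j < q" for j
    using that m kexp_eq_Suc_kdeg[of m' m j n] by (simp add: K_def d_def q)
  have K_q: "K q = Suc N"
    by (simp add: K_def kexp_def q N_def)
  have S: "S + (q + m') = (\<Sum>i<Suc q. i) + (\<Sum>i\<le>m'. i)"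
    using sum_kdeg[of m' q] m(1) by (simp add: S_def d_def q)
  \<comment> \<open>The Chebyshev coefficient kills the wrong parity, the Vandermonde factor the
    right one.\<close>
  have A0: "A e = 0" if "e < q + m'" for e
  proof (cases "even (N + e)")
    case True
    then have "even (e + q + m')"
      using n by (simp add: N_def algebra_simps)
    then show ?thesis
      using kdeg_prod_eq_0[of m' q e] m(1) that by (simp add: A_def d' q)
  next
    case False
    then show ?thesis using chebU_parity[of N e] by (simp add: A_def)
  qed
  have A_odd: "A e = 0" if "odd (N + e)" for e
    using chebU_parity[OF that] by (simp add: A_def)
  have A_gt: "A e = 0" if "e > N" for e
    using that degree_chebU[of N] by (simp add: A_def coeff_eq_0)
  \<comment> \<open>The factor \<open>(e + 2) (e + 1)\<close> produced by
    \<open>kdeg_prod_shift\<close> is absorbed by the Chebyshev recurrence; the remaining linear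
    factors are those of \<open>Y\<close> up to a common 4.\<close>
  have rec_A: "(real r + 1) * (real r + real m' + 1/2) * A (q + m' + 2 * Suc r) =
      (real r - real v) * (real r + real v + real m + real m') * A (q + m' + 2 * r)" for r
  proof -
    define e where "e = q + m' + 2 * r"
    have e2: "q + m' + 2 * Suc r = e + 2" by (simp add: e_def)
    have f1: "real e + 2 - real d = 2 * real r + 2 * real m' + 1"
      using m(1) by (simp add: e_def d_def q of_nat_diff)
    have f2: "real e + 1 + real d - 2 * real q = 2 * real r + 2"
      using m(1) by (simp add: e_def d_def q of_nat_diff)
    have f3: "(real e - real N) * (real e + real N + 2) =
        4 * ((real r - real v) * (real r + real v + real m + real m'))"
      by (simp add: e_def N_def n q algebra_simps)
    have "4 * ((real r + 1) * (real r + real m' + 1/2) * A (e + 2)) =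
        coeff (chebU N) (e + 2) * ((real e + 2 - real d) * (real e + 1 + real d - 2 * real q) * kdeg_prod d q (e + 2))"
      unfolding f1 f2 A_def by (simp add: algebra_simps)
    also have "\<dots> = (real ((e + 2) * (e + 1)) * coeff (chebU N) (e + 2)) * kdeg_prod d q e"
      unfolding kdeg_prod_shift[OF d_le] by (simp add: algebra_simps)
    also have "\<dots> = 4 * ((real r - real v) * (real r + real v + real m + real m') * A e)"
      unfolding chebU_coeff_rec f3 A_def by (simp add: algebra_simps)
    finally show ?thesis unfolding e2 e_def[symmetric] by simp
  qed
  \<comment> \<open>Downward from the top index \<open>v\<close>, where \<open>Y\<close> is monic;
    for \<open>r < v\<close> the factor \<open>(r - v) (r + v + m + m')\<close> is nonzero and
    cancels.\<close>
  have A_Y: "A (q + m' + 2 * r) = A N * coeff Y r" if "r \<le> v" for r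
    using that
  proof (induction rule: inc_induct)
    case base
    then show ?case by (simp add: N_def n Y(2))
  next
    case (step r)
    let ?c = "(real r - real v) * (real r + real v + real m + real m')"
    have "?c * A (q + m' + 2 * r) = (real r + 1) * (real r + real m' + 1/2) * A (q + m' + 2 * Suc r)"
      using rec_A[of r] by simp
    also have "\<dots> = A N * ((real r + 1) * (real r + real m' + 1/2) * coeff Y (Suc r))"
      using step.IH by simp
    also have "\<dots> = ?c * (A N * coeff Y r)"
      using rec[OF step.hyps(2)] by simp
    finally show ?case
      using step.hyps(2) m(2) by simp
  qed
  let ?p = "\<lambda>j. chebU (K j - 1)"
  have inj: "inj_on (kdeg d) {..<q}"
    using strict_mono_kdeg strict_mono_imp_inj_on inj_on_subset by blast
  have V: "(\<Prod>j<q. \<Prod>i<j. real (kdeg d j) - real (kdeg d i)) = (\<Prod>j<q. \<Prod>i<j. real (K j) - real (K i))"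
    by (intro prod.cong) (auto simp: K_less)
  have comb: "Polynomial.smult (a * b) (Polynomial.smult (c * d) (monom 1 (x + y) * Z)) =
      monom 1 x * Polynomial.smult ((a * c) * (b * d)) (monom 1 y * Z)" for a b c d :: real and x y Z
  proof -
    have "monom 1 (x + y) = monom 1 x * monom (1 :: real) y" by (simp add: mult_monom)
    then show ?thesis by (simp add: mult_ac)
  qed
  have "monom 1 (\<Sum>i<Suc q. i) * pwronskian m ?p =
      Polynomial.smult ((\<Prod>j<q. coeff (?p j) (kdeg d j)) * (\<Prod>j<q. \<Prod>i<j. real (kdeg d j) - real (kdeg d i)))
       (\<Sum>e\<le>degree (?p q). monom (coeff (?p q) e * (\<Prod>i<q. real e - real (kdeg d i))) (e + (\<Sum>j<q. kdeg d j)))"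
    unfolding q by (rule pwronskian_monomial_span[OF inj]) (auto simp: K_less intro: chebU_kdeg_span)
  also have "(\<Prod>j<q. coeff (?p j) (kdeg d j)) = (\<Prod>j<q. 2 ^ (K j - 1))"
    by (intro prod.cong) (auto simp: K_less lead_coeff_chebU)
  also have "(\<Sum>e\<le>degree (?p q). monom (coeff (?p q) e * (\<Prod>i<q. real e - real (kdeg d i))) (e + (\<Sum>j<q. kdeg d j)))
      = (\<Sum>e\<le>degree (chebU N). monom (A e) (e + S))"
    by (simp add: K_q A_def kdeg_prod_def S_def)
  \<comment> \<open>\<open>A\<close> is supported on exponents from \<open>q + m'\<close> to
    \<open>N = q + m' + 2 v\<close> with the parity of \<open>N\<close>.\<close>
  also have "\<dots> = (\<Sum>e\<in>(\<lambda>r. q + m' + 2 * r) ` {..v}. monom (A e) (e + S))"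
  proof (rule sum.mono_neutral_cong)
    show "monom (A e) (e + S) = 0" if "e \<in> {..degree (chebU N)} - (\<lambda>r. q + m' + 2 * r) ` {..v}" for e
    proof (rule ccontr)
      assume "monom (A e) (e + S) \<noteq> 0"
      then have "A e \<noteq> 0" by auto
      then have "q + m' \<le> e" "e \<le> N" "even (N + e)"
        using A0 A_gt A_odd by (meson linorder_not_less)+
      then obtain k where k: "e = q + m' + k" using le_Suc_ex by blast
      with \<open>even (N + e)\<close> have "even k" by (simp add: N_def n)
      with k \<open>e \<le> N\<close> have "e \<in> (\<lambda>r. q + m' + 2 * r) ` {..v}"
        by (auto simp: N_def n elim!: evenE)
      with that show False by blast
    qed
    show "monom (A e) (e + S) = 0" if "e \<in> (\<lambda>r. q + m' + 2 * r) ` {..v} - {..degree (chebU N)}" for e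
      using that by (auto simp: A_def coeff_eq_0)
  qed auto
  also have "\<dots> = (\<Sum>r\<le>v. monom (A (q + m' + 2 * r)) (q + m' + 2 * r + S))"
    by (subst sum.reindex) (auto simp: inj_on_def)
  also have "\<dots> = (\<Sum>r\<le>v. monom (A N * coeff Y r) (S + (q + m') + 2 * r))"
    by (intro sum.cong refl arg_cong2[where f = monom]) (auto simp: A_Y)
  also have "\<dots> = Polynomial.smult (A N) (monom 1 (S + (q + m')) * pcompose Y (monom 1 2))"
  proof -
    have "poly (pcompose Y (monom 1 2)) = poly (\<Sum>r\<le>v. monom (coeff Y r) (2 * r))"
      by (rule ext) (simp add: poly_pcompose poly_altdef[of Y] Y(1) poly_sum poly_monom power_mult)
    then have "pcompose Y (monom 1 2) = (\<Sum>r\<le>v. monom (coeff Y r) (2 * r))"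
      by (simp only: poly_eq_poly_eq_iff)
    then show ?thesis
      by (simp add: sum_distrib_left mult_monom smult_sum_right smult_monom)
  qed
  also have "A N = 2 ^ (K q - 1) * (\<Prod>i<q. real (K q) - real (K i))"
    by (simp add: A_def lead_coeff_chebU K_q kdeg_prod_def K_less)
  finally have E: "monom 1 (\<Sum>i<Suc q. i) * pwronskian m ?p = monom 1 (\<Sum>i<Suc q. i) *
      Polynomial.smult ((\<Prod>j<m. 2 ^ (K j - 1)) * (\<Prod>j<m. \<Prod>i<j. real (K j) - real (K i)))
      (monom 1 (\<Sum>i\<le>m'. i) * pcompose Y (monom 1 2))"
    unfolding S V comb by (simp only: q prod.lessThan_Suc)
  have V2: "(\<Prod>j<m. 2 ^ (K j - 1)) = (2 :: real) ^ ((\<Sum>i<m. i) + (\<Sum>i\<le>m'. i) + n)"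
  proof -
    have "(\<Sum>j<m. K j - 1) = S + N"
      by (simp add: q S_def K_less K_q)
    also have "\<dots> = (\<Sum>i<m. i) + (\<Sum>i\<le>m'. i) + n"
      using S by (simp add: N_def q)
    finally show ?thesis by (simp only: flip: power_sum)
  qed
  have "monom (1 :: real) (\<Sum>i<Suc q. i) \<noteq> 0"
    by simp
  from mult_left_cancel[THEN iffD1, OF this E] V2 show ?thesis
    by (simp only: K_def)
qed

subsection \<open>The polynomial of a configuration\<close>

text \<open>The hypothesis says that \<open>s (1 - s) Y'' + (a - (1 + b) s) Y'\<close> vanishes at the roots of \<open>Y\<close>, so
  that it is a constant multiple of \<open>Y\<close>.\<close>

lemma jacobi_coeff_rec:
  fixes R :: "real set" and a b :: real
  assumes fin: "finite R"
    and eq: "\<And>s. s \<in> R \<Longrightarrow> 2 * s * (1 - s) * (\<Sum>r\<in>R - {s}. 1 / (s - r)) = (1 + b) * s - a"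
  defines "Y \<equiv> \<Prod>r\<in>R. [:- r, 1:]"
  shows "(real k + 1) * (real k + a) * coeff Y (Suc k) =
    (real k - real (card R)) * (real k + real (card R) + b) * coeff Y k"
proof -
  define v where "v = card R"
  \<comment> \<open>The constant \<open>v (v + b)\<close> cancels the coefficient at degree
    \<open>v\<close>; then \<open>v\<close> roots force \<open>F = 0\<close>.\<close>
  define F where "F = [:0, 1, -1:] * pderiv (pderiv Y) + [:a, - (1 + b):] * pderiv Y
    + Polynomial.smult (real v * (real v + b)) Y"
  have degY: "degree Y = v"
    unfolding Y_def v_def by (subst degree_prod_eq_sum_degree) auto
  have F: "F = monom 1 1 * pderiv (pderiv Y) - monom 1 2 * pderiv (pderiv Y) + Polynomial.smult a (pderiv Y)
    - monom (1 + b) 1 * pderiv Y + Polynomial.smult (real v * (real v + b)) Y"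
  proof -
    have "[:0, 1, -1:] = monom 1 1 - monom (1 :: real) 2" "[:a, - (1 + b):] = [:a:] - monom (1 + b) 1"
      by (simp_all add: monom_altdef numeral_2_eq_2)
    then show ?thesis by (simp add: F_def left_diff_distrib)
  qed
  have cF: "coeff F k = (real k + 1) * (real k + a) * coeff Y (Suc k) -
    (real k - real v) * (real k + real v + b) * coeff Y k" for k
    unfolding F coeff_add coeff_diff coeff_smult coeff_monom_mult
    by (cases k rule: chebU.cases) (simp_all add: coeff_pderiv algebra_simps)
  have root: "poly F s = 0" if s: "s \<in> R" for s
  proof -
    \<comment> \<open>At \<open>s\<close> one has \<open>Y' = Z\<close> and
      \<open>Y'' = 2 Z'\<close>, and the sum of reciprocals is the logarithmic derivative of
      \<open>Z\<close>.\<close>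
    define Z where "Z = (\<Prod>r\<in>R - {s}. [:- r, 1:])"
    have Y: "Y = [:- s, 1:] * Z"
      unfolding Y_def Z_def using fin s by (simp add: prod.remove)
    have "poly (pderiv Z) s = (\<Sum>r\<in>R - {s}. \<Prod>t\<in>R - {s} - {r}. s - t)"
      by (simp add: Z_def pderiv_prod pderiv_pCons poly_sum poly_prod)
    also have "\<dots> = (\<Sum>r\<in>R - {s}. poly Z s * (1 / (s - r)))"
    proof (rule sum.cong)
      fix r assume r: "r \<in> R - {s}"
      then have "poly Z s = (s - r) * (\<Prod>t\<in>R - {s} - {r}. s - t)"
        using fin by (simp add: Z_def poly_prod prod.remove left_diff_distrib)
      then show "(\<Prod>t\<in>R - {s} - {r}. s - t) = poly Z s * (1 / (s - r))"
        using r by simp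
    qed simp
    finally have Z': "poly (pderiv Z) s = poly Z s * (\<Sum>r\<in>R - {s}. 1 / (s - r))"
      by (simp only: sum_distrib_left)
    have dY: "pderiv Y = [:- s, 1:] * pderiv Z + Z"
      by (simp only: Y pderiv_mult) (simp add: pderiv_pCons)
    have ddY: "pderiv (pderiv Y) = [:- s, 1:] * pderiv (pderiv Z) + pderiv Z + pderiv Z"
      by (simp only: dY pderiv_add pderiv_mult) (simp add: pderiv_pCons)
    have "poly F s = poly Z s * (2 * s * (1 - s) * (\<Sum>r\<in>R - {s}. 1 / (s - r)) - ((1 + b) * s - a))"
      unfolding F_def ddY unfolding dY poly_add poly_mult poly_smult Z' by (simp add: Y algebra_simps)
    then show ?thesis using eq[OF s] by simp
  qed
  have "F = 0"
  proof (rule poly_eqI_degree_lead_coeff[where A = R and n = v])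
    show "coeff F v = coeff 0 v"
      using degY by (simp add: cF coeff_eq_0)
    show "degree F \<le> v"
      by (rule degree_le) (use degY in \<open>auto simp: cF coeff_eq_0\<close>)
  qed (use root in \<open>auto simp: v_def\<close>)
  with cF[of k] show ?thesis by (simp add: v_def)
qed

section \<open>Angles modulo pi and cotangents\<close>

lemma sin_diff_times_sin_add: "sin (a - b) * sin (a + b) = (cos b)\<^sup>2 - (cos a)\<^sup>2" for a b :: real
proof -
  have "sin (a - b) * sin (a + b) = (sin a)\<^sup>2 * (cos b)\<^sup>2 - (cos a)\<^sup>2 * (sin b)\<^sup>2"
    by (simp add: sin_add sin_diff power2_eq_square algebra_simps)
  then show ?thesis by (simp add: sin_squared_eq algebra_simps)
qed

lemma cot_diff_eq:
  fixes a b :: real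
  assumes "sin a \<noteq> 0" "sin b \<noteq> 0"
  shows "cot a - cot b = sin (b - a) / (sin a * sin b)"
  using assms by (simp add: cot_def sin_diff field_simps)

text \<open>\<open>sin (a - b) = 0\<close> expresses that the angles agree modulo pi, the sense in
  which they describe the same line.\<close>

lemma cot_cong:
  fixes a b :: real
  assumes "sin (a - b) = 0" "sin b \<noteq> 0"
  shows "cot a = cot b"
proof -
  have "sin a \<noteq> 0"
  proof
    assume "sin a = 0"
    then have "cos a * sin b = 0" using assms(1) by (simp add: sin_diff)
    with assms(2) \<open>sin a = 0\<close> show False
      using sin_cos_squared_add[of a] by auto
  qed
  then show ?thesis using assms by (simp add: cot_def sin_diff field_simps)
qed

lemma cis_add_cis_minus: "cis d + cis (- d) = 2 * of_real (cos d)"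
  and cis_diff_cis_minus: "cis d - cis (- d) = 2 * \<i> * of_real (sin d)"
  by (simp_all add: complex_eq_iff)

text \<open>The phase halfway between the two points cancels and leaves the quotient of
  \<open>2 cos\<close> and \<open>2 i sin\<close>. For coinciding points both sides are 0 by the
  convention for division by zero.\<close>

lemma zpt_ratio:
  "(zpt \<phi> i + zpt \<phi> j) / (zpt \<phi> i - zpt \<phi> j) = - \<i> * of_real (cot (\<phi> i - \<phi> j))"
proof -
  let ?E = "cis (\<phi> i + \<phi> j)" and ?d = "\<phi> i - \<phi> j"
  have z: "zpt \<phi> i = ?E * cis ?d" "zpt \<phi> j = ?E * cis (- ?d)"
    by (simp_all add: cis_mult) (simp_all add: zpt_def cis_conv_exp mult_ac)
  have add: "zpt \<phi> i + zpt \<phi> j = ?E * (2 * of_real (cos ?d))"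
    unfolding z by (simp only: cis_add_cis_minus flip: distrib_left)
  have diff: "zpt \<phi> i - zpt \<phi> j = ?E * (2 * \<i> * of_real (sin ?d))"
    unfolding z by (simp only: cis_diff_cis_minus flip: right_diff_distrib)
  show ?thesis
    unfolding add diff cot_def of_real_divide
    by (cases "sin ?d = 0") (simp_all add: field_simps)
qed

lemma collinear_dir:
  assumes "sin (a - b) = 0"
  shows "collinear {0, dir a, dir b}"
proof -
  have "dir b = cos (a - b) *\<^sub>R dir a"
  proof -
    have "cos b = cos (a - b) * cos a" "sin b = cos (a - b) * sin a"
      using cos_diff[of a "a - b"] sin_diff[of a "a - b"] assms by simp_all
    then show ?thesis by (simp add: dir_def)
  qed
  then show ?thesis by (auto simp: collinear_lemma)
qed

text \<open>Writing \<open>ln |u|\<close> as \<open>ln (u^2) / 2\<close> avoids a case distinction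
  on the sign.\<close>

lemma DERIV_ln_abs:
  assumes "(f has_real_derivative D) (at x)" "f x \<noteq> 0"
  shows "((\<lambda>x. ln \<bar>f x\<bar>) has_real_derivative D / f x) (at x)"
proof -
  have eq: "ln \<bar>u\<bar> = ln (u\<^sup>2) / 2" for u :: real
    using ln_realpow[of "\<bar>u\<bar>" 2] by (cases "u = 0") auto
  have "0 < f x * f x"
    using assms(2) by (metis not_real_square_gt_zero)
  then have "((\<lambda>x. ln ((f x)\<^sup>2) / 2) has_real_derivative D / f x) (at x)"
    using assms by (auto intro!: derivative_eq_intros simp: power2_eq_square field_simps)
  then show ?thesis by (simp only: eq)
qed

section \<open>Mirror pairs of lines and the equilibrium equations\<close>

locale configuration =
  fixes m m' n :: nat and \<phi> :: "nat \<Rightarrow> real"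
  assumes config: "is_configuration m m' n \<phi>" and normalized: "dir (\<phi> 0) = (1, 0)"
begin

lemma sin_diff_nonzero:
  "s \<le> n + 1 \<Longrightarrow> t \<le> n + 1 \<Longrightarrow> s \<noteq> t \<Longrightarrow> sin (\<phi> s - \<phi> t) \<noteq> 0"
  using config collinear_dir[of "\<phi> s" "\<phi> t"] by (auto simp: is_configuration_def)

lemma axis0: "cos (\<phi> 0) = 1" "sin (\<phi> 0) = 0"
  using normalized by (auto simp: dir_def)

lemma axis1: "cos (\<phi> (n + 1)) = 0" "sin (\<phi> (n + 1)) \<noteq> 0"
proof -
  show "cos (\<phi> (n + 1)) = 0"
    using config axis0 by (auto simp: is_configuration_def real_inner_class.orthogonal_def dir_def inner_prod_def)
  then show "sin (\<phi> (n + 1)) \<noteq> 0"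
    using sin_cos_squared_add[of "\<phi> (n + 1)"] by auto
qed

lemma sin_cos_nonzero:
  assumes "j \<in> {1..n}"
  shows "sin (\<phi> j) \<noteq> 0" "cos (\<phi> j) \<noteq> 0"
  using sin_diff_nonzero[of j 0] sin_diff_nonzero[of j "n + 1"] assms axis0 axis1
  by (auto simp: sin_diff)

text \<open>The reflection sends line \<open>j\<close> to some line \<open>t\<close> of angle
  \<open>- \<phi> j\<close> modulo pi; since line \<open>j\<close> is not an axis, \<open>t\<close>
  is neither an axis nor \<open>j\<close>.\<close>

lemma mirror:
  assumes j: "j \<in> {1..n}"
  obtains t where "t \<in> {1..n}" "t \<noteq> j" "sin (\<phi> j + \<phi> t) = 0"
proof -
  let ?H = "\<lambda>s. hyperplane (dir (\<phi> s))" and ?u = "(- sin (\<phi> j), cos (\<phi> j))"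
  have "?u \<in> ?H j"
    by (simp add: hyperplane_def dir_def)
  then have "reflection (dir (\<phi> 0)) ?u \<in> reflection (dir (\<phi> 0)) ` ?H j"
    by (rule imageI)
  moreover have "reflection (dir (\<phi> 0)) ?u = (sin (\<phi> j), cos (\<phi> j))"
    by (simp add: reflection_def normalized)
  moreover have "reflection (dir (\<phi> 0)) ` ?H j \<in> ?H ` {0..n + 1}"
  proof -
    have "(\<lambda>H. reflection (dir (\<phi> 0)) ` H) ` (?H ` {0..n + 1}) = ?H ` {0..n + 1}"
      using config unfolding is_configuration_def by blast
    moreover have "?H j \<in> ?H ` {0..n + 1}" using j by auto
    ultimately show ?thesis by blast
  qed
  ultimately have "(sin (\<phi> j), cos (\<phi> j)) \<in> \<Union> (?H ` {0..n + 1})" by (metis UnionI)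
  then obtain t where t: "t \<le> n + 1" "(sin (\<phi> j), cos (\<phi> j)) \<in> ?H t" by auto
  then have s: "sin (\<phi> j + \<phi> t) = 0"
    by (simp add: hyperplane_def dir_def sin_add algebra_simps)
  note nz = sin_cos_nonzero[OF j]
  have "t \<noteq> 0"
    using s nz axis0 by (intro notI) (simp add: sin_add)
  moreover have "t \<noteq> n + 1"
    using s nz axis1 by (intro notI) (simp add: sin_add)
  moreover have "t \<noteq> j"
    using s nz by (intro notI) (simp add: sin_double)
  ultimately have "t \<in> {1..n}" using t(1) by auto
  then show ?thesis using \<open>t \<noteq> j\<close> s by (rule that)
qed

text \<open>The coordinate that mirror lines share; its values become the roots of
  \<open>Y\<close>.\<close>

definition sq :: "nat \<Rightarrow> real" where "sq j = (cos (\<phi> j))\<^sup>2"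

text \<open>By \<open>sin_diff_times_sin_add\<close>, equal values of \<open>sq\<close> mean angles
  equal or opposite modulo pi, and no two lines coincide.\<close>

lemma fibre:
  assumes j: "j \<in> {1..n}" and t: "t \<in> {1..n}" "t \<noteq> j" "sin (\<phi> j + \<phi> t) = 0"
  shows "{i \<in> {1..n}. sq i = sq j} = {j, t}"
proof -
  have "i = j \<or> i = t" if i: "i \<in> {1..n}" "sq i = sq j" for i
  proof (rule ccontr)
    assume "\<not> (i = j \<or> i = t)"
    then have ne: "sin (\<phi> i - \<phi> j) \<noteq> 0" "sin (\<phi> i - \<phi> t) \<noteq> 0"
      using sin_diff_nonzero i(1) j t(1) by auto
    have "sin (\<phi> i - \<phi> j) * sin (\<phi> i + \<phi> j) = 0"
      using i(2) by (simp add: sin_diff_times_sin_add sq_def)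
    with ne have "sin (\<phi> i + \<phi> j) = 0" by simp
    with t(3) have "sin ((\<phi> i + \<phi> j) - (\<phi> j + \<phi> t)) = 0"
      by (simp only: sin_diff)
    with ne(2) show False by simp
  qed
  moreover have "sq t = sq j"
    using sin_diff_times_sin_add[of "\<phi> j" "\<phi> t"] t(3) by (simp add: sq_def)
  ultimately show ?thesis using j t(1) by auto
qed

definition R :: "real set" where "R = sq ` {1..n}"

lemma finite_R: "finite R" by (simp add: R_def)

lemma fibre_cases:
  assumes "s \<in> R"
  obtains j t where "j \<in> {1..n}" "t \<in> {1..n}" "t \<noteq> j" "sin (\<phi> j + \<phi> t) = 0" "sq j = s"
    "{i \<in> {1..n}. sq i = s} = {j, t}"
proof -
  obtain j where j: "j \<in> {1..n}" "sq j = s" using assms by (auto simp: R_def)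
  obtain t where "t \<in> {1..n}" "t \<noteq> j" "sin (\<phi> j + \<phi> t) = 0" by (rule mirror[OF j(1)])
  with j fibre[OF j(1)] that show ?thesis by blast
qed

lemma card_R: "n = 2 * card R"
proof -
  have "card {1..n} = (\<Sum>s\<in>R. \<Sum>i\<in>{i \<in> {1..n}. sq i = s}. 1)"
    using sum.group[of "{1..n}" R sq "\<lambda>_. 1 :: nat"] by (simp add: R_def)
  also have "\<dots> = (\<Sum>s\<in>R. 2)"
  proof (rule sum.cong)
    fix s assume "s \<in> R"
    then show "(\<Sum>i\<in>{i \<in> {1..n}. sq i = s}. 1) = (2 :: nat)"
      by (rule fibre_cases) simp
  qed simp
  finally show ?thesis by simp
qed

text \<open>The real form of the configuration equations: \<open>zpt_ratio\<close> gives cotangents,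
  and the terms of the two axes move to the right.\<close>

lemma balance:
  assumes j: "j \<in> {1..n}"
  shows "(\<Sum>i\<in>{1..n} - {j}. cot (\<phi> i - \<phi> j)) = real m * cot (\<phi> j) - real m' * tan (\<phi> j)"
proof -
  let ?c = "\<lambda>i. real (cfg_mult m m' n i) * cot (\<phi> i - \<phi> j)"
  have "0 = (\<Sum>i\<in>{0..n+1} - {j}. of_nat (cfg_mult m m' n i) * (zpt \<phi> i + zpt \<phi> j) / (zpt \<phi> i - zpt \<phi> j))"
    using config j by (simp add: is_configuration_def)
  also have "\<dots> = (\<Sum>i\<in>{0..n+1} - {j}. - \<i> * of_real (?c i))"
    by (intro sum.cong refl) (simp only: times_divide_eq_right[symmetric] zpt_ratio, simp)
  also have "\<dots> = - \<i> * of_real (\<Sum>i\<in>{0..n+1} - {j}. ?c i)"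
    by (simp only: sum_distrib_left of_real_sum)
  finally have "(\<Sum>i\<in>{0..n+1} - {j}. ?c i) = 0"
    by (simp del: of_real_sum)
  moreover have "{0..n+1} - {j} = insert 0 (insert (n + 1) ({1..n} - {j}))"
    using j by auto
  moreover have "(\<Sum>i\<in>{1..n} - {j}. ?c i) = (\<Sum>i\<in>{1..n} - {j}. cot (\<phi> i - \<phi> j))"
    by (intro sum.cong) (auto simp: cfg_mult_def)
  moreover have "cot (\<phi> 0 - \<phi> j) = - cot (\<phi> j)"
    by (simp add: cot_def sin_diff cos_diff axis0)
  moreover have "cot (\<phi> (n + 1) - \<phi> j) = tan (\<phi> j)"
    using axis1 by (simp add: cot_def tan_def sin_diff cos_diff)
  ultimately show ?thesis
    using j by (simp add: cfg_mult_def)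
qed

text \<open>Grouping \<open>balance\<close> by mirror pairs turns each pair of other lines into one
  term in \<open>s - r\<close>; multiplying by \<open>sin (2 * \<phi> j)\<close> makes everything
  rational in \<open>s\<close>.\<close>

lemma stieltjes:
  assumes s: "s \<in> R"
  shows "2 * s * (1 - s) * (\<Sum>r\<in>R - {s}. 1 / (s - r)) = (1 + (real m + real m')) * s - (real m' + 1/2)"
proof -
  obtain j t where j: "j \<in> {1..n}" and t: "t \<in> {1..n}" "t \<noteq> j" "sin (\<phi> j + \<phi> t) = 0"
    and js: "sq j = s" and fib: "{i \<in> {1..n}. sq i = s} = {j, t}"
    by (rule fibre_cases[OF s])
  note nz = sin_cos_nonzero[OF j]
  let ?S = "\<Sum>r\<in>R - {s}. 1 / (s - r)"
  \<comment> \<open>The value 0 at \<open>j\<close> allows summation over complete fibres of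
    \<open>sq\<close>.\<close>
  let ?c = "\<lambda>i. if i = j then 0 else cot (\<phi> i - \<phi> j)"
  have pair: "(\<Sum>i\<in>{i \<in> {1..n}. sq i = r}. ?c i) = sin (2 * \<phi> j) * (1 / (s - r))" if r: "r \<in> R - {s}" for r
  proof -
    obtain i u where i: "i \<in> {1..n}" and u: "u \<in> {1..n}" "u \<noteq> i" "sin (\<phi> i + \<phi> u) = 0"
      and ir: "sq i = r" and fib': "{i \<in> {1..n}. sq i = r} = {i, u}"
      using fibre_cases r by blast
    have "u \<in> {i \<in> {1..n}. sq i = r}" using fib' by blast
    then have ne: "i \<noteq> j" "u \<noteq> j" using ir js r by auto
    have D: "sin (\<phi> i - \<phi> j) * sin (\<phi> i + \<phi> j) = s - r"
      using ir js by (simp add: sin_diff_times_sin_add sq_def)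
    then have nz': "sin (\<phi> i - \<phi> j) \<noteq> 0" "sin (\<phi> i + \<phi> j) \<noteq> 0"
      using r by auto
    have "cot (\<phi> u - \<phi> j) = cot (- (\<phi> i + \<phi> j))"
    proof (rule cot_cong)
      show "sin (\<phi> u - \<phi> j - - (\<phi> i + \<phi> j)) = 0"
        using u(3) by (simp add: add.commute)
      show "sin (- (\<phi> i + \<phi> j)) \<noteq> 0" using nz' by (simp only: sin_minus)
    qed
    also have "\<dots> = - cot (\<phi> i + \<phi> j)"
      by (simp only: cot_def cos_minus sin_minus minus_divide_right)
    finally have "(\<Sum>i\<in>{i \<in> {1..n}. sq i = r}. ?c i) = cot (\<phi> i - \<phi> j) - cot (\<phi> i + \<phi> j)"
      unfolding fib' using ne u(2) by simp
    also have "\<dots> = sin (2 * \<phi> j) / (s - r)"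
      using cot_diff_eq[OF nz'] by (simp add: D)
    finally show ?thesis by simp
  qed
  have "(\<Sum>i\<in>{1..n} - {j}. cot (\<phi> i - \<phi> j)) = (\<Sum>i\<in>{1..n}. ?c i)"
    by (rule sum.mono_neutral_cong_left) auto
  also have "\<dots> = (\<Sum>r\<in>R. \<Sum>i\<in>{i \<in> {1..n}. sq i = r}. ?c i)"
    using sum.group[of "{1..n}" R sq ?c] by (simp add: R_def)
  also have "\<dots> = (\<Sum>i\<in>{i \<in> {1..n}. sq i = s}. ?c i)
      + (\<Sum>r\<in>R - {s}. \<Sum>i\<in>{i \<in> {1..n}. sq i = r}. ?c i)"
    by (rule sum.remove[OF finite_R s])
  also have "(\<Sum>r\<in>R - {s}. \<Sum>i\<in>{i \<in> {1..n}. sq i = r}. ?c i)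
      = (\<Sum>r\<in>R - {s}. sin (2 * \<phi> j) * (1 / (s - r)))"
    by (rule sum.cong[OF refl pair])
  also have "{i \<in> {1..n}. sq i = s} = {j, t}"
    by (rule fib)
  also have "(\<Sum>i\<in>{j, t}. ?c i) = cot (\<phi> t - \<phi> j)"
    using t(2) by simp
  \<comment> \<open>The partner \<open>t\<close> of \<open>j\<close> itself has the angle
    \<open>- \<phi> j\<close> modulo pi.\<close>
  also have "\<dots> = cot (- (2 * \<phi> j))"
    using t(3) nz by (intro cot_cong) (simp_all add: sin_double add.commute)
  also have "\<dots> = - cot (2 * \<phi> j)" by (simp add: cot_def)
  finally have *: "sin (2 * \<phi> j) * ?S - cot (2 * \<phi> j) = real m * cot (\<phi> j) - real m' * tan (\<phi> j)"
    unfolding balance[OF j] sum_distrib_left by simp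
  have "sin (2 * \<phi> j) * sin (2 * \<phi> j) * ?S - sin (2 * \<phi> j) * cot (2 * \<phi> j) =
      sin (2 * \<phi> j) * (sin (2 * \<phi> j) * ?S - cot (2 * \<phi> j))"
    by (simp only: right_diff_distrib mult.assoc)
  also have "\<dots> = real m * (sin (2 * \<phi> j) * cot (\<phi> j)) - real m' * (sin (2 * \<phi> j) * tan (\<phi> j))"
    unfolding * by (simp add: algebra_simps)
  finally have "sin (2 * \<phi> j) * sin (2 * \<phi> j) * ?S - sin (2 * \<phi> j) * cot (2 * \<phi> j) =
      real m * (sin (2 * \<phi> j) * cot (\<phi> j)) - real m' * (sin (2 * \<phi> j) * tan (\<phi> j))" .
  moreover have "sin (2 * \<phi> j) * cot (2 * \<phi> j) = 2 * s - 1"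
    using nz js by (simp add: cot_def sin_double cos_double_cos sq_def)
  moreover have "sin (2 * \<phi> j) * sin (2 * \<phi> j) = 4 * s * (1 - s)"
  proof -
    have "sin (2 * \<phi> j) * sin (2 * \<phi> j) = 4 * (cos (\<phi> j))\<^sup>2 * (sin (\<phi> j))\<^sup>2"
      by (simp add: sin_double power2_eq_square)
    then show ?thesis by (simp add: sin_squared_eq js[symmetric] sq_def)
  qed
  moreover have "sin (2 * \<phi> j) * cot (\<phi> j) = 2 * s"
    unfolding js[symmetric] sq_def using nz by (simp add: sin_double cot_def power2_eq_square)
  moreover have "sin (2 * \<phi> j) * tan (\<phi> j) = 2 * (1 - s)"
  proof -
    have "sin (2 * \<phi> j) * tan (\<phi> j) = 2 * (sin (\<phi> j))\<^sup>2"
      using nz by (simp add: sin_double tan_def power2_eq_square)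
    then show ?thesis by (simp add: sin_squared_eq js[symmetric] sq_def)
  qed
  ultimately have "4 * s * (1 - s) * ?S - (2 * s - 1) = real m * (2 * s) - real m' * (2 * (1 - s))"
    by (simp only:)
  then show ?thesis by (simp add: algebra_simps)
qed

section \<open>The polynomial \<open>Y\<close>, the function \<open>Q\<close> and the
  Wronskian\<close>

definition Y :: "real poly" where "Y = (\<Prod>r\<in>R. [:- r, 1:])"

lemma degree_Y: "degree Y = card R"
  unfolding Y_def by (subst degree_prod_eq_sum_degree) auto

lemma lead_coeff_Y: "coeff Y (card R) = 1"
proof -
  have "lead_coeff Y = 1" by (simp add: Y_def lead_coeff_prod)
  then show ?thesis by (simp add: degree_Y)
qed

lemma Y_coeff_rec:
  "(real k + 1) * (real k + real m' + 1/2) * coeff Y (Suc k) =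
    (real k - real (card R)) * (real k + real (card R) + real m + real m') * coeff Y k"
  using jacobi_coeff_rec[OF finite_R stieltjes, of k] by (simp add: Y_def add_ac)

text \<open>The prefactor is distributed evenly over the \<open>n\<close> factors; those of a mirror
  pair then multiply to the real number \<open>4 (cos^2 x - r)\<close>.\<close>

lemma Q_fun_eq: "Q_fun n \<phi> x = of_real (2 ^ n * poly Y ((cos x)\<^sup>2))"
proof -
  let ?f = "\<lambda>j. exp (- \<i> * of_real x) * (exp (2 * \<i> * of_real x) - exp (2 * \<i> * of_real (\<phi> j)))"
  have "Q_fun n \<phi> x = (\<Prod>j=1..n. ?f j)"
    by (simp add: Q_fun_def prod.distrib exp_of_nat_mult[symmetric] mult_ac)
  also have "\<dots> = (\<Prod>r\<in>R. \<Prod>i\<in>{i \<in> {1..n}. sq i = r}. ?f i)"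
    using prod.group[of "{1..n}" R sq ?f] by (simp add: R_def)
  also have "\<dots> = (\<Prod>r\<in>R. of_real (4 * ((cos x)\<^sup>2 - r)))"
  proof (rule prod.cong)
    fix r assume "r \<in> R"
    then obtain j t where "j \<in> {1..n}" "t \<in> {1..n}"
      and j: "t \<noteq> j" "sin (\<phi> j + \<phi> t) = 0" "sq j = r"
      and fib: "{i \<in> {1..n}. sq i = r} = {j, t}"
      by (rule fibre_cases)
    have f: "?f i = cis x - cis (2 * \<phi> i - x)" for i
      by (simp add: cis_conv_exp right_diff_distrib exp_add[symmetric] algebra_simps)
    \<comment> \<open>Angles opposite modulo pi become opposite modulo 2 pi when doubled.\<close>
    have "cis (2 * \<phi> t) = cis (- (2 * \<phi> j))"
    proof -
      have "cos (2 * (\<phi> j + \<phi> t)) = 1" "sin (2 * (\<phi> j + \<phi> t)) = 0"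
        using j(2) by (simp_all only: cos_double_sin sin_double) simp_all
      then have "cis (2 * \<phi> j) * cis (2 * \<phi> t) = 1"
        by (simp add: cis_mult complex_eq_iff distrib_left)
      then have "cis (- (2 * \<phi> j)) * (cis (2 * \<phi> j) * cis (2 * \<phi> t)) = cis (- (2 * \<phi> j))"
        by simp
      then show ?thesis by (simp add: mult.assoc[symmetric] cis_mult)
    qed
    then have ft: "?f t = cis x - cis (- (2 * \<phi> j) - x)"
      unfolding f by (simp only: cis_divide[symmetric])
    have "(\<Prod>i\<in>{i \<in> {1..n}. sq i = r}. ?f i) = ?f j * ?f t"
      unfolding fib using j(1) by simp
    also have "\<dots> = cis (2 * x) + cis (- (2 * x)) - (cis (2 * \<phi> j) + cis (- (2 * \<phi> j)))"
      unfolding ft f[of j] by (simp add: cis_mult algebra_simps)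
    also have "\<dots> = of_real (2 * cos (2 * x) - 2 * cos (2 * \<phi> j))"
      by (simp add: complex_eq_iff)
    also have "2 * cos (2 * x) - 2 * cos (2 * \<phi> j) = 4 * ((cos x)\<^sup>2 - r)"
      using j(3) by (simp add: cos_double_cos sq_def)
    finally show "(\<Prod>i\<in>{i \<in> {1..n}. sq i = r}. ?f i) = of_real (4 * ((cos x)\<^sup>2 - r))" .
  qed simp
  also have "\<dots> = of_real (4 ^ card R * poly Y ((cos x)\<^sup>2))"
    by (simp add: Y_def poly_prod prod.distrib del: right_diff_distrib_numeral)
  also have "(4 :: real) ^ card R = 2 ^ (2 * card R)"
    by (simp add: power_mult)
  also have "2 * card R = n"
    using card_R by (rule sym)
  finally show ?thesis .
qed

text \<open>Comparing absolute values of the two expressions for \<open>Q\<close> avoids tracking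
  signs and phases.\<close>

lemma abs_Y: "\<bar>poly Y ((cos x)\<^sup>2)\<bar> = (\<Prod>j=1..n. \<bar>sin (x - \<phi> j)\<bar>)"
proof -
  have "norm (exp (2 * \<i> * of_real x) - exp (2 * \<i> * of_real a)) = 2 * \<bar>sin (x - a)\<bar>" for a
  proof -
    have "exp (2 * \<i> * of_real x) - exp (2 * \<i> * of_real a) = cis (x + a) * (cis (x - a) - cis (a - x))"
      by (simp add: cis_mult right_diff_distrib) (simp add: cis_conv_exp mult_ac)
    also have "cis (x - a) - cis (a - x) = 2 * \<i> * of_real (sin (x - a))"
      using cis_diff_cis_minus[of "x - a"] by simp
    finally show ?thesis by (simp add: norm_mult)
  qed
  then have "norm (Q_fun n \<phi> x) = 2 ^ n * (\<Prod>j=1..n. \<bar>sin (x - \<phi> j)\<bar>)"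
    by (simp add: Q_fun_def norm_mult prod_norm[symmetric] prod.distrib)
  then show ?thesis
    unfolding Q_fun_eq norm_of_real by (simp add: abs_mult)
qed

text \<open>Collects the sign from \<open>wronskian_sin_poly_cos\<close>, the Chebyshev leading
  coefficients and the Vandermonde product of the exponents.\<close>

definition lead :: real where
  "lead = (-1) ^ (m * (m - 1) div 2) * 2 ^ (m * (m - 1) div 2 + m' * (m' + 1) div 2 + n) *
    (\<Prod>j<m. \<Prod>i<j. real (kexp m m' n (Suc j)) - real (kexp m m' n (Suc i)))"

lemma wronskian_chi:
  assumes m: "m' \<le> m" "m \<ge> 1 \<or> n = 0"
  shows "wronskian m (chi m m' n) x =
    lead * sin x ^ (m * (m + 1) div 2) * cos x ^ (m' * (m' + 1) div 2) * poly Y ((cos x)\<^sup>2)"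
proof (cases "m = 0")
  \<comment> \<open>Here \<open>n = 0\<close> by assumption, so the empty determinant and
    \<open>Y\<close> are both 1.\<close>
  case True
  then have n: "n = 0" and m': "m' = 0" using m by auto
  have "R = sq ` {1..n}" by (rule R_def)
  also have "\<dots> = {}" using n by simp
  finally have "Y = 1" by (simp add: Y_def)
  then show ?thesis
    unfolding wronskian_def lead_def \<open>Y = 1\<close> using True m' n by simp
next
  case False
  have chi: "chi m m' n (Suc j) x = sin x * poly (chebU (kexp m m' n (Suc j) - 1)) (cos x)" if "j < m" for j x
  proof -
    have "kexp m m' n (Suc j) = Suc (kexp m m' n (Suc j) - 1)"
      using that m(1) by (auto simp: kexp_def)
    then show ?thesis
      unfolding chi_def by (metis sin_chebU)
  qed
  have "pwronskian m (\<lambda>j. chebU (kexp m m' n (Suc j) - 1)) =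
    Polynomial.smult (2 ^ ((\<Sum>i<m. i) + (\<Sum>i\<le>m'. i) + n) *
        (\<Prod>j<m. \<Prod>i<j. real (kexp m m' n (Suc j)) - real (kexp m m' n (Suc i))))
      (monom 1 (\<Sum>i\<le>m'. i) * pcompose Y (monom 1 2))"
    using m(1) False card_R degree_Y lead_coeff_Y Y_coeff_rec
    by (intro pwronskian_chebU_kexp[where v = "card R"]) auto
  moreover have "wronskian m (chi m m' n) x = (-1) ^ (m * (m - 1) div 2) * sin x ^ (m * (m + 1) div 2) *
      poly (pwronskian m (\<lambda>j. chebU (kexp m m' n (Suc j) - 1))) (cos x)"
    by (rule wronskian_sin_poly_cos) (rule chi)
  ultimately show ?thesis
    unfolding lead_def by (simp add: sum_lessThan_nat sum_atMost_nat poly_monom poly_pcompose mult_ac)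
qed

text \<open>The exponents \<open>k\<close> are strictly increasing, so the Vandermonde product is
  nonzero and cancels against its reciprocal in \<open>nu\<close>; the sign is its own
  inverse.\<close>

lemma nu_lead:
  assumes "m' \<le> m"
  shows "nu m m' n * lead = 2 ^ n"
proof -
  let ?V = "\<Prod>j<m. \<Prod>i<j. real (kexp m m' n (Suc j)) - real (kexp m m' n (Suc i))"
  let ?a = "m * (m - 1) div 2" and ?b = "m' * (m' + 1) div 2"
  have inv: "(\<Prod>i\<in>A. inverse (h i)) = inverse (\<Prod>i\<in>A. h i)" for A and h :: "nat \<Rightarrow> real"
    using prod_inversef[of h A] by (simp add: comp_def)
  have "(\<Prod>p=1..m. \<Prod>q=1..<p. inverse (real (kexp m m' n p) - real (kexp m m' n q)))
      = (\<Prod>j<m. \<Prod>i<j. inverse (real (kexp m m' n (Suc j)) - real (kexp m m' n (Suc i))))"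
    by (simp only: prod.atLeast1_atMost_eq atLeastLessThanSuc_atLeastAtMost One_nat_def)
  also have "\<dots> = inverse ?V"
    by (simp only: inv)
  finally have V: "(\<Prod>p=1..m. \<Prod>q=1..<p. inverse (real (kexp m m' n p) - real (kexp m m' n q))) = inverse ?V" .
  have "real (kexp m m' n (Suc j)) - real (kexp m m' n (Suc i)) \<noteq> 0" if "i < j" "j < m" for i j
    using kexp_less_kexp[OF assms that, of n] by simp
  then have "?V \<noteq> 0"
    by (simp add: prod_zero_iff del: right_minus_eq)
  moreover have "(2 :: real) powi (- int ?b - int ?a) = inverse (2 ^ (?a + ?b))"
  proof -
    have "- int b - int a = - int (a + b)" for a b by simp
    then show ?thesis by (simp only: power_int_minus power_int_of_nat)
  qed
  moreover have "((-1) ^ ?a * (-1) ^ ?a :: real) = 1"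
    by (simp flip: power_mult_distrib)
  ultimately show ?thesis
    unfolding nu_def lead_def V by (simp add: power_add field_simps)
qed

section \<open>Logarithmic derivatives of the Wronskian\<close>

lemma nonsingular_open: "open {x. nonsingular m m' n \<phi> x}"
proof -
  have "{x. nonsingular m m' n \<phi> x} =
      ({x. m = 0 \<or> sin x \<noteq> 0} \<inter> {x. m' = 0 \<or> cos x \<noteq> 0}) \<inter> (\<Inter>j\<in>{1..n}. {x. sin (x - \<phi> j) \<noteq> 0})"
    by (auto simp: nonsingular_def off_axes_def)
  also have "open \<dots>"
    by (intro open_Int open_INT ballI finite_atLeastAtMost open_Collect_disj open_Collect_const
        open_Collect_neq continuous_intros)
  finally show ?thesis .
qed

lemma ln_abs_wronskian:
  assumes m: "m' \<le> m" "m \<ge> 1 \<or> n = 0" and x: "nonsingular m m' n \<phi> x"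
  shows "ln \<bar>wronskian m (chi m m' n) x\<bar> =
    ln \<bar>lead\<bar> + real (m * (m + 1) div 2) * ln \<bar>sin x\<bar> + real (m' * (m' + 1) div 2) * ln \<bar>cos x\<bar>
      + (\<Sum>j=1..n. ln \<bar>sin (x - \<phi> j)\<bar>)"
proof -
  have lead: "lead \<noteq> 0" using nu_lead[OF m(1)] by auto
  have P: "(\<Prod>j=1..n. \<bar>sin (x - \<phi> j)\<bar>) > 0"
    using x by (intro prod_pos) (auto simp: nonsingular_def)
  \<comment> \<open>For \<open>k = 0\<close> the power is 1 and its logarithm 0, so \<open>u\<close>
    may vanish; this covers an axis of multiplicity 0.\<close>
  have pw: "ln (\<bar>u\<bar> ^ (k * (k + 1) div 2)) = real (k * (k + 1) div 2) * ln \<bar>u\<bar>"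
    and pw': "\<bar>u\<bar> ^ (k * (k + 1) div 2) > 0" if "k = 0 \<or> u \<noteq> 0" for k and u :: real
    using that by (auto simp: ln_realpow)
  have s: "m = 0 \<or> sin x \<noteq> 0" and c: "m' = 0 \<or> cos x \<noteq> 0"
    using x by (auto simp: nonsingular_def off_axes_def)
  have "\<bar>wronskian m (chi m m' n) x\<bar> = \<bar>lead\<bar> * \<bar>sin x\<bar> ^ (m * (m + 1) div 2)
      * \<bar>cos x\<bar> ^ (m' * (m' + 1) div 2) * (\<Prod>j=1..n. \<bar>sin (x - \<phi> j)\<bar>)"
    by (simp only: wronskian_chi[OF m] abs_mult power_abs abs_Y)
  also have "ln \<dots> = ln \<bar>lead\<bar> + real (m * (m + 1) div 2) * ln \<bar>sin x\<bar> + real (m' * (m' + 1) div 2) * ln \<bar>cos x\<bar>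
      + ln (\<Prod>j=1..n. \<bar>sin (x - \<phi> j)\<bar>)"
  proof -
    have "ln (a * b * c * d) = ln a + ln b + ln c + ln d" if "a > 0" "b > 0" "c > 0" "d > 0"
      for a b c d :: real
      using that by (simp add: ln_mult_pos)
    from this[OF _ pw'[OF s] pw'[OF c] P, of "\<bar>lead\<bar>"] show ?thesis
      using lead by (simp only: pw[OF s] pw[OF c])
  qed
  also have "ln (\<Prod>j=1..n. \<bar>sin (x - \<phi> j)\<bar>) = (\<Sum>j=1..n. ln \<bar>sin (x - \<phi> j)\<bar>)"
    using x by (intro ln_prod) (auto simp: nonsingular_def)
  finally show ?thesis .
qed

text \<open>The second derivatives of \<open>ln |sin|\<close> and \<open>ln |cos|\<close> are
  \<open>- 1 / sin^2\<close> and \<open>- 1 / cos^2\<close>; the factor \<open>- 2\<close> and the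
  triangular exponents produce the coefficients of the potential.\<close>

lemma deriv2_ln_abs_wronskian:
  assumes m: "m' \<le> m" "m \<ge> 1 \<or> n = 0" and x: "nonsingular m m' n \<phi> x"
  shows "- 2 * (deriv ^^ 2) (\<lambda>y. ln \<bar>wronskian m (chi m m' n) y\<bar>) x = potential m m' n \<phi> x"
proof -
  define M M' where "M = real (m * (m + 1) div 2)" and "M' = real (m' * (m' + 1) div 2)"
  define U where "U = {x. nonsingular m m' n \<phi> x}"
  let ?f = "\<lambda>y. ln \<bar>wronskian m (chi m m' n) y\<bar>"
  let ?F = "\<lambda>y. ln \<bar>lead\<bar> + M * ln \<bar>sin y\<bar> + M' * ln \<bar>cos y\<bar> + (\<Sum>j=1..n. ln \<bar>sin (y - \<phi> j)\<bar>)"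
  let ?g = "\<lambda>y. M * (cos y / sin y) + M' * (- sin y / cos y) + (\<Sum>j=1..n. cos (y - \<phi> j) / sin (y - \<phi> j))"
  have U: "open U" "x \<in> U"
    using nonsingular_open x by (auto simp: U_def)
  have s: "M = 0 \<or> sin y \<noteq> 0" and c: "M' = 0 \<or> cos y \<noteq> 0"
    and sj: "j \<in> {1..n} \<Longrightarrow> sin (y - \<phi> j) \<noteq> 0" if "y \<in> U" for y j
    using that by (auto simp: U_def nonsingular_def off_axes_def M_def M'_def)
  have F: "(?F has_real_derivative ?g y) (at y)" if y: "y \<in> U" for y
  proof -
    have A: "((\<lambda>y. M * ln \<bar>sin y\<bar>) has_real_derivative M * (cos y / sin y)) (at y)"
    proof (cases "M = 0")
      case False
      with s[OF y] show ?thesis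
        by (intro DERIV_cmult DERIV_ln_abs DERIV_sin) simp
    qed simp
    have B: "((\<lambda>y. M' * ln \<bar>cos y\<bar>) has_real_derivative M' * (- sin y / cos y)) (at y)"
    proof (cases "M' = 0")
      case False
      with c[OF y] show ?thesis
        by (intro DERIV_cmult DERIV_ln_abs DERIV_cos) simp
    qed simp
    have C: "((\<lambda>y. \<Sum>j=1..n. ln \<bar>sin (y - \<phi> j)\<bar>) has_real_derivative
        (\<Sum>j=1..n. cos (y - \<phi> j) / sin (y - \<phi> j))) (at y)"
      using sj[OF y] by (intro DERIV_sum DERIV_ln_abs) (auto intro!: derivative_eq_intros)
    show ?thesis
      using DERIV_add[OF DERIV_add[OF DERIV_add[OF DERIV_const[of "ln \<bar>lead\<bar>"] A] B] C]
      by (simp only: add_0)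
  qed
  have f: "deriv ?f y = ?g y" if y: "y \<in> U" for y
  proof (rule DERIV_imp_deriv)
    \<comment> \<open>The sum formula is available only on \<open>U\<close>, whose openness lets the
      derivative pass to \<open>ln |W|\<close>.\<close>
    show "(?f has_real_derivative ?g y) (at y)"
      using F[OF y] U(1) y
    proof (rule has_field_derivative_transform_within_open)
      show "?F y = ?f y" if "y \<in> U" for y
        using that ln_abs_wronskian[OF m] by (simp add: U_def M_def M'_def)
    qed
  qed
  let ?h = "\<lambda>y. M * (- 1 / (sin y)\<^sup>2) + M' * (- 1 / (cos y)\<^sup>2) + (\<Sum>j=1..n. - 1 / (sin (y - \<phi> j))\<^sup>2)"
  have cot': "((\<lambda>y. cos (y - a) / sin (y - a)) has_real_derivative - 1 / (sin (y - a))\<^sup>2) (at y)"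
    if "sin (y - a) \<noteq> 0" for a y :: real
    using that sin_cos_squared_add[of "y - a"]
    by (auto intro!: derivative_eq_intros simp: divide_simps power2_eq_square)
  have tan': "((\<lambda>y. - sin y / cos y) has_real_derivative - 1 / (cos y)\<^sup>2) (at y)"
    if "cos y \<noteq> 0" for y :: real
    using that sin_cos_squared_add[of y]
    by (auto intro!: derivative_eq_intros simp: divide_simps power2_eq_square)
  have "((\<lambda>y. M * (cos y / sin y)) has_real_derivative M * (- 1 / (sin x)\<^sup>2)) (at x)"
  proof (cases "M = 0")
    case False
    with s[OF U(2)] cot'[of x 0] show ?thesis
      by (intro DERIV_cmult) simp
  qed simp
  moreover have "((\<lambda>y. M' * (- sin y / cos y)) has_real_derivative M' * (- 1 / (cos x)\<^sup>2)) (at x)"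
  proof (cases "M' = 0")
    case False
    with c[OF U(2)] show ?thesis
      by (intro DERIV_cmult tan') simp
  qed simp
  moreover have "((\<lambda>y. \<Sum>j=1..n. cos (y - \<phi> j) / sin (y - \<phi> j)) has_real_derivative
      (\<Sum>j=1..n. - 1 / (sin (x - \<phi> j))\<^sup>2)) (at x)"
    using sj[OF U(2)] by (intro DERIV_sum cot') auto
  ultimately have "(?g has_real_derivative ?h x) (at x)"
    by (intro DERIV_add)
  then have "(deriv ?f has_real_derivative ?h x) (at x)"
    using U by (rule has_field_derivative_transform_within_open) (simp add: f)
  then have "(deriv ^^ 2) ?f x = ?h x"
    by (simp add: DERIV_imp_deriv numeral_2_eq_2)
  moreover have "real (m * (m + 1)) = 2 * M" "real (m' * (m' + 1)) = 2 * M'"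
    unfolding M_def M'_def by (simp_all add: real_of_nat_div)
  ultimately show ?thesis
    by (simp only: potential_def) (simp add: sum_negf sum_distrib_left)
qed

end

text \<open>\<open>W\<close> may be negative, hence the absolute value under the logarithm. For
  \<open>m = 0\<close> the empty Wronskian is 1 and cannot produce the \<open>n\<close> terms of the
  potential, hence \<open>n = 0\<close> in that case.\<close>

theorem theorem4p5:
  fixes m m' n :: nat and \<phi> :: "nat \<Rightarrow> real"
  assumes "m' \<le> m"
    and "even n"
    and "m \<ge> 1 \<or> n = 0"
    and "is_configuration m m' n \<phi>"
    and "dir (\<phi> 0) = (1, 0)"
  shows "(\<forall>(f :: real \<Rightarrow> real) x. nonsingular m m' n \<phi> x \<longrightarrow>
            L_op m m' n \<phi> f x =
              - (deriv ^^ 2) f x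
              - 2 * (deriv ^^ 2) (\<lambda>y. ln \<bar>wronskian m (chi m m' n) y\<bar>) x * f x) \<and>
         (\<forall>x. off_axes m m' x \<longrightarrow>
            Q_fun n \<phi> x =
              complex_of_real (nu m m' n
                * cos x powi (- int (m' * (m' + 1) div 2))
                * sin x powi (- int (m * (m + 1) div 2))
                * wronskian m (chi m m' n) x))"
proof (intro conjI allI impI)
  interpret configuration m m' n \<phi>
    using assms by unfold_locales
  fix f :: "real \<Rightarrow> real" and x
  assume "nonsingular m m' n \<phi> x"
  then show "L_op m m' n \<phi> f x = - (deriv ^^ 2) f x
      - 2 * (deriv ^^ 2) (\<lambda>y. ln \<bar>wronskian m (chi m m' n) y\<bar>) x * f x"
    unfolding L_op_def by (simp flip: deriv2_ln_abs_wronskian[OF assms(1,3)])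
next
  interpret configuration m m' n \<phi>
    using assms by unfold_locales
  fix x
  assume "off_axes m m' x"
  \<comment> \<open>Where \<open>sin\<close> or \<open>cos\<close> vanishes, \<open>off_axes\<close>
    makes its exponent 0 and the power 1.\<close>
  then have s: "sin x ^ (m * (m + 1) div 2) \<noteq> 0" and c: "cos x ^ (m' * (m' + 1) div 2) \<noteq> 0"
    by (auto simp: off_axes_def)
  have "nu m m' n * cos x powi (- int (m' * (m' + 1) div 2)) * sin x powi (- int (m * (m + 1) div 2))
      * wronskian m (chi m m' n) x = nu m m' n * lead * poly Y ((cos x)\<^sup>2)"
    using s c unfolding wronskian_chi[OF assms(1,3)]
    by (simp add: power_int_minus field_simps)
  also have "\<dots> = 2 ^ n * poly Y ((cos x)\<^sup>2)"
    by (simp only: nu_lead[OF assms(1)])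
  finally show "Q_fun n \<phi> x = complex_of_real (nu m m' n
      * cos x powi (- int (m' * (m' + 1) div 2)) * sin x powi (- int (m * (m + 1) div 2))
      * wronskian m (chi m m' n) x)"
    by (simp only: Q_fun_eq)
qed

end
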